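(* Let $(M,g)$ be a smooth Riemannian surface and $p_0\in M$. Suppose that $I_{4b}=0$ identically near $p_0$, but either $J_5\ne0$ or $J_4\neq0$ at $p_0$, where $$J_5=5I_3(I_{5a}-I_{5c})+(I_{4a}-I_{4c})(I_{4c}-6I_{4a})-25I_2I_3^3,$$ $$J_4=3(I_{4a}-I_{4c})(I_{4a}+4I_{4c})I_{4c}-15I_2I_3^3(I_{4a}+4I_{4c})+25I_3^5.$$ Then $g$ is Liouville near $p_0$ if and only if $I_{5d}=0$ identically near $p_0$, and in this case there exists only one additional (independent of the Hamiltonian) quadratic integral, i.e. $\dim\mathcal J_2=2$.
   Context: Let $H=\sum g^{ij}p_ip_j$ be the Hamiltonian of the geodesic flow of $g$ on $T^*M$. Everything is local: $\mathcal J_n=\mathcal J_n(g)$ denotes the real vector space of germs at $p_0$ of integrals homogeneous of degree $n$ in momenta, i.e. of functions $F=\sum_{i+j=n}u_{ij}(x,y)p_x^ip_y^j$ defined on $T^*U$ for some neighbourhood $U$ of $p_0$, with smooth $u_{ij}$, such that $\{H,F\}=0$ (canonical Poisson bracket). The metric $g$ is called Liouville near $p_0$ if there is a quadratic integral near $p_0$ that is not a constant multiple of $H$, i.e. $\dim\mathcal J_2\ge2$. Differential invariants: $K$ is the Gaussian curvature, $\nabla$ the Levi-Civita connection, $\operatorname{grad}K$ the $g$-gradient of $K$, and $\operatorname{sgrad}K$ its rotation by $\pi/2$ (a local orientation is fixed). Put $d_\nabla^{\otimes1}K=dK$ and $(d_\nabla^{\otimes l}K)(\xi_1,\dots,\xi_l)=(\nabla_{\xi_1}d_\nabla^{\otimes(l-1)}K)(\xi_2,\dots,\xi_l)$.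 Set $I_2=K$, $I_3=|\operatorname{grad}K|^2$, and for $i=l+2\ge4$, $0\le j\le l$, $$I_{ij}=d_\nabla^{\otimes l}K(\underbrace{\operatorname{grad}K,\dots,\operatorname{grad}K}_{l-j},\underbrace{\operatorname{sgrad}K,\dots,\operatorname{sgrad}K}_{j}),$$ with the index $j=0,1,2,3,\dots$ written as a letter $a,b,c,d,\dots$ (e.g. $I_{4b}=I_{41}$, $I_{5d}=I_{53}$). *)

theory Defs
  imports "HOL-Analysis.Analysis"
begin

section \<open>Smooth functions and Riemannian surfaces\<close>

definition pd :: "2 \<Rightarrow> (real^2 \<Rightarrow> real) \<Rightarrow> real^2 \<Rightarrow> real" where
  "pd i f x = frechet_derivative f (at x) (axis i 1)"

text \<open>Only used for open \<open>U\<close>. Every iterated partial derivative is required to be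
  (totally) differentiable, hence continuous, so this is the class of
  infinitely differentiable functions.\<close>

definition smooth_on :: "(real^2) set \<Rightarrow> (real^2 \<Rightarrow> real) \<Rightarrow> bool" where
  "smooth_on U f \<longleftrightarrow> (\<forall>is. \<forall>x\<in>U. foldr pd is f differentiable (at x))"

type_synonym 'a chart = "'a set \<times> ('a \<Rightarrow> real^2)"

abbreviation chart_image :: "'a chart \<Rightarrow> (real^2) set" where
  "chart_image c \<equiv> snd c ` fst c"

definition transition :: "'a chart \<Rightarrow> 'a chart \<Rightarrow> real^2 \<Rightarrow> real^2" where
  "transition c d = snd d \<circ> inv_into (fst c) (snd c)"

definition smooth_surface :: "'a topology \<Rightarrow> 'a chart set \<Rightarrow> bool" where
  "smooth_surface M A \<longleftrightarrow>
     Hausdorff_space M \<and> second_countable M \<and>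
     (\<Union>c\<in>A. fst c) = topspace M \<and>
     (\<forall>c\<in>A. openin M (fst c) \<and> open (chart_image c) \<and>
        homeomorphic_map (subtopology M (fst c)) (top_of_set (chart_image c)) (snd c)) \<and>
     (\<forall>c\<in>A. \<forall>d\<in>A. \<forall>i. smooth_on (snd c ` (fst c \<inter> fst d)) (\<lambda>x. transition c d x $ i))"

text \<open>A metric is given by its coefficient matrices \<open>g c x\<close> in each chart \<open>c\<close> of the atlas,
  subject to the transformation law of a covariant 2-tensor.\<close>

type_synonym metric = "real^2 \<Rightarrow> real^2^2"

definition riemannian_surface ::
    "'a topology \<Rightarrow> 'a chart set \<Rightarrow> ('a chart \<Rightarrow> metric) \<Rightarrow> bool" where
  "riemannian_surface M A g \<longleftrightarrow>
     smooth_surface M A \<and>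
     (\<forall>c\<in>A. (\<forall>i j. smooth_on (chart_image c) (\<lambda>x. g c x $ i $ j)) \<and>
        (\<forall>x\<in>chart_image c. transpose (g c x) = g c x \<and>
           (\<forall>v. v \<noteq> 0 \<longrightarrow> v \<bullet> (g c x *v v) > 0))) \<and>
     (\<forall>c\<in>A. \<forall>d\<in>A. \<forall>x\<in>snd c ` (fst c \<inter> fst d).
        let D = matrix (frechet_derivative (transition c d) (at x))
        in g c x = transpose D ** g d (transition c d x) ** D)"


section \<open>Curvature and differential invariants in a chart\<close>

definition christoffel :: "metric \<Rightarrow> 2 \<Rightarrow> 2 \<Rightarrow> 2 \<Rightarrow> real^2 \<Rightarrow> real" where
  "christoffel g k i j x = (\<Sum>l\<in>UNIV. matrix_inv (g x) $ k $ l *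
     (pd i (\<lambda>y. g y $ j $ l) x + pd j (\<lambda>y. g y $ i $ l) x - pd l (\<lambda>y. g y $ i $ j) x)) / 2"

text \<open>\<open>R(\<partial>\<^sub>i, \<partial>\<^sub>j) \<partial>\<^sub>k = (\<Sum>l. riemann g l k i j \<partial>\<^sub>l)\<close>
  with \<open>R(X,Y) = [\<nabla>\<^sub>X, \<nabla>\<^sub>Y] - \<nabla>\<close> along \<open>[X,Y]\<close>;
  the Gaussian curvature is then \<open>g(R(\<partial>\<^sub>1, \<partial>\<^sub>2) \<partial>\<^sub>2, \<partial>\<^sub>1) / det g\<close>,
  positive on round spheres.\<close>

definition riemann :: "metric \<Rightarrow> 2 \<Rightarrow> 2 \<Rightarrow> 2 \<Rightarrow> 2 \<Rightarrow> real^2 \<Rightarrow> real" where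
  "riemann g l k i j x =
     pd i (christoffel g l j k) x - pd j (christoffel g l i k) x
     + (\<Sum>m\<in>UNIV. christoffel g l i m x * christoffel g m j k x
                  - christoffel g l j m x * christoffel g m i k x)"

definition gauss_curvature :: "metric \<Rightarrow> real^2 \<Rightarrow> real" where
  "gauss_curvature g x = (\<Sum>l\<in>UNIV. g x $ 1 $ l * riemann g l 2 1 2 x) / det (g x)"

text \<open>A covariant tensor field of rank \<open>l\<close> is given by its components \<open>T is x\<close>, for index
  lists \<open>is\<close> of length \<open>l\<close>. The index of the differentiating vector comes first.\<close>

type_synonym cov_tensor = "2 list \<Rightarrow> real^2 \<Rightarrow> real"

fun cov_deriv :: "metric \<Rightarrow> cov_tensor \<Rightarrow> cov_tensor" where
  "cov_deriv g T [] x = 0"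
| "cov_deriv g T (k # is) x = pd k (T is) x
     - (\<Sum>m<length is. \<Sum>s\<in>UNIV. christoffel g s k (is ! m) x * T (is[m := s]) x)"

text \<open>Rank 0 is the function \<open>K\<close> itself, so rank 1 is \<open>dK\<close>.\<close>

primrec iter_diff_K :: "metric \<Rightarrow> nat \<Rightarrow> cov_tensor" where
  "iter_diff_K g 0 = (\<lambda>is. gauss_curvature g)"
| "iter_diff_K g (Suc l) = cov_deriv g (iter_diff_K g l)"

definition tensor_eval :: "cov_tensor \<Rightarrow> real^2 \<Rightarrow> (real^2) list \<Rightarrow> real" where
  "tensor_eval T x vs =
     (\<Sum>is | length is = length vs. T is x * (\<Prod>m<length vs. vs ! m $ (is ! m)))"

definition grad_K :: "metric \<Rightarrow> real^2 \<Rightarrow> real^2" where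
  "grad_K g x = matrix_inv (g x) *v (\<chi> i. pd i (gauss_curvature g) x)"

text \<open>Rotation by \<open>\<pi>/2\<close> with respect to \<open>g x\<close> and the local orientation: \<open>\<sigma> = 1\<close> if the
  coordinate frame is positively oriented, \<open>\<sigma> = -1\<close> otherwise.\<close>

definition rot90 :: "metric \<Rightarrow> real \<Rightarrow> real^2 \<Rightarrow> real^2 \<Rightarrow> real^2" where
  "rot90 g \<sigma> x v = (\<sigma> / sqrt (det (g x))) *\<^sub>R vector [- ((g x *v v) $ 2), (g x *v v) $ 1]"

lemma rot90_is_rotation:
  assumes "transpose (g x) = g x" "det (g x) > 0" "\<sigma> \<in> {1, -1}"
  shows "v \<bullet> (g x *v rot90 g \<sigma> x v) = 0"
    and "rot90 g \<sigma> x v \<bullet> (g x *v rot90 g \<sigma> x v) = v \<bullet> (g x *v v)"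
    and "\<sigma> * det (vector [v, rot90 g \<sigma> x v]) * sqrt (det (g x)) = v \<bullet> (g x *v v)"
proof -
  define a b c where "a = g x $ 1 $ 1" and "b = g x $ 1 $ 2" and "c = g x $ 2 $ 2"
  have sym: "g x $ 2 $ 1 = b"
    using arg_cong[OF assms(1), of "\<lambda>m. m $ 1 $ 2"] by (simp add: b_def transpose_def)
  define s where "s = sqrt (det (g x))"
  have s: "s > 0" "s * s = a * c - b * b"
    using assms(2) by (auto simp: s_def a_def b_def c_def det_2 sym)
  have sg: "\<sigma> * \<sigma> = 1" using assms(3) by auto
  define p q where "p = v $ 1" and "q = v $ 2"
  define w where "w = rot90 g \<sigma> x v"
  have w: "w $ 1 = \<sigma> / s * (- (b * p + c * q))" "w $ 2 = \<sigma> / s * (a * p + b * q)"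
    by (simp_all add: w_def rot90_def s_def[symmetric] matrix_vector_mult_def sum_2
        sym a_def[symmetric] b_def[symmetric] c_def[symmetric] p_def q_def)
  have quad: "u \<bullet> (g x *v z) = a * u$1 * z$1 + b * (u$1 * z$2 + u$2 * z$1) + c * u$2 * z$2" for u z
    by (simp add: inner_vec_def matrix_vector_mult_def sum_2 sym a_def b_def c_def algebra_simps)
  show "v \<bullet> (g x *v rot90 g \<sigma> x v) = 0"
    unfolding w_def[symmetric] quad w p_def[symmetric] q_def[symmetric]
    by (simp add: algebra_simps)
  have ss: "\<sigma> / s * (\<sigma> / s) * (a * c - b * b) = 1"
    using s(1) sg unfolding s(2)[symmetric] by (simp add: divide_simps)
  have "w \<bullet> (g x *v w) = (\<sigma> / s * (\<sigma> / s) * (a * c - b * b)) * (v \<bullet> (g x *v v))"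
    unfolding quad w p_def[symmetric] q_def[symmetric] by algebra
  then show "rot90 g \<sigma> x v \<bullet> (g x *v rot90 g \<sigma> x v) = v \<bullet> (g x *v v)"
    unfolding w_def ss by simp
  have ss': "\<sigma> * (\<sigma> / s) * s = 1" using s(1) sg by simp
  have "\<sigma> * (p * w $ 2 - q * w $ 1) * s = (\<sigma> * (\<sigma> / s) * s) * (v \<bullet> (g x *v v))"
    unfolding quad w p_def[symmetric] q_def[symmetric] by algebra
  then show "\<sigma> * det (vector [v, rot90 g \<sigma> x v]) * sqrt (det (g x)) = v \<bullet> (g x *v v)"
    unfolding ss' w_def[symmetric] s_def[symmetric] by (simp add: det_2 p_def q_def mult.commute)
qed

definition sgrad_K :: "metric \<Rightarrow> real \<Rightarrow> real^2 \<Rightarrow> real^2" where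
  "sgrad_K g \<sigma> x = rot90 g \<sigma> x (grad_K g x)"

definition I2 :: "metric \<Rightarrow> real^2 \<Rightarrow> real" where
  "I2 g x = gauss_curvature g x"

definition I3 :: "metric \<Rightarrow> real^2 \<Rightarrow> real" where
  "I3 g x = grad_K g x \<bullet> (g x *v grad_K g x)"

text \<open>\<open>Iij g \<sigma> i j\<close> is meant for \<open>4 \<le> i\<close> and \<open>j \<le> i - 2\<close>.\<close>

definition Iij :: "metric \<Rightarrow> real \<Rightarrow> nat \<Rightarrow> nat \<Rightarrow> real^2 \<Rightarrow> real" where
  "Iij g \<sigma> i j x = tensor_eval (iter_diff_K g (i - 2)) x
     (replicate (i - 2 - j) (grad_K g x) @ replicate j (sgrad_K g \<sigma> x))"

abbreviation "I4a g \<sigma> \<equiv> Iij g \<sigma> 4 0"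
abbreviation "I4b g \<sigma> \<equiv> Iij g \<sigma> 4 1"
abbreviation "I4c g \<sigma> \<equiv> Iij g \<sigma> 4 2"
abbreviation "I5a g \<sigma> \<equiv> Iij g \<sigma> 5 0"
abbreviation "I5c g \<sigma> \<equiv> Iij g \<sigma> 5 2"
abbreviation "I5d g \<sigma> \<equiv> Iij g \<sigma> 5 3"

definition J5 :: "metric \<Rightarrow> real \<Rightarrow> real^2 \<Rightarrow> real" where
  "J5 g \<sigma> x = 5 * I3 g x * (I5a g \<sigma> x - I5c g \<sigma> x)
     + (I4a g \<sigma> x - I4c g \<sigma> x) * (I4c g \<sigma> x - 6 * I4a g \<sigma> x)
     - 25 * I2 g x * I3 g x ^ 3"

definition J4 :: "metric \<Rightarrow> real \<Rightarrow> real^2 \<Rightarrow> real" where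
  "J4 g \<sigma> x = 3 * (I4a g \<sigma> x - I4c g \<sigma> x) * (I4a g \<sigma> x + 4 * I4c g \<sigma> x) * I4c g \<sigma> x
     - 15 * I2 g x * I3 g x ^ 3 * (I4a g \<sigma> x + 4 * I4c g \<sigma> x)
     + 25 * I3 g x ^ 5"


section \<open>Germs of functions on the cotangent bundle\<close>

text \<open>Functions on the cotangent bundle, in coordinates \<open>(x, p)\<close>, up to equality over a
  neighbourhood of the base point \<open>x = 0\<close>. Germs at other points are obtained by translation.\<close>

quotient_type cotangent_germ = "real^2 \<Rightarrow> real^2 \<Rightarrow> real" /
  "\<lambda>F G. \<forall>\<^sub>F x in nhds 0. \<forall>p. F x p = G x p"
proof (rule equivpI)
  show "reflp (\<lambda>F G :: real^2 \<Rightarrow> real^2 \<Rightarrow> real. \<forall>\<^sub>F x in nhds 0. \<forall>p. F x p = G x p)"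
    by (simp add: reflp_def)
  show "symp (\<lambda>F G :: real^2 \<Rightarrow> real^2 \<Rightarrow> real. \<forall>\<^sub>F x in nhds 0. \<forall>p. F x p = G x p)"
    by (simp add: symp_def eq_commute)
  show "transp (\<lambda>F G :: real^2 \<Rightarrow> real^2 \<Rightarrow> real. \<forall>\<^sub>F x in nhds 0. \<forall>p. F x p = G x p)"
    by (auto simp: transp_def elim: eventually_elim2)
qed

instantiation cotangent_germ :: real_vector
begin

lift_definition zero_cotangent_germ :: cotangent_germ is "\<lambda>x p. 0" .

lift_definition plus_cotangent_germ :: "cotangent_germ \<Rightarrow> cotangent_germ \<Rightarrow> cotangent_germ"
  is "\<lambda>F G x p. F x p + G x p" by (auto elim: eventually_elim2)

lift_definition uminus_cotangent_germ :: "cotangent_germ \<Rightarrow> cotangent_germ"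
  is "\<lambda>F x p. - F x p" by (auto elim: eventually_mono)

lift_definition minus_cotangent_germ :: "cotangent_germ \<Rightarrow> cotangent_germ \<Rightarrow> cotangent_germ"
  is "\<lambda>F G x p. F x p - G x p" by (auto elim: eventually_elim2)

lift_definition scaleR_cotangent_germ :: "real \<Rightarrow> cotangent_germ \<Rightarrow> cotangent_germ"
  is "\<lambda>r F x p. r * F x p" by (auto elim: eventually_mono)

instance
  by standard (transfer; simp add: algebra_simps)+

end

definition germ_at :: "real^2 \<Rightarrow> (real^2 \<Rightarrow> real^2 \<Rightarrow> real) \<Rightarrow> cotangent_germ" where
  "germ_at x0 F = abs_cotangent_germ (\<lambda>x p. F (x0 + x) p)"

lemma germ_at_eq_iff:
  "germ_at x0 F = germ_at x0 G \<longleftrightarrow> (\<forall>\<^sub>F x in nhds x0. \<forall>p. F x p = G x p)"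
proof -
  have *: "nhds x0 = filtermap (\<lambda>x. x0 + x) (nhds 0)"
    using filtermap_nhds_shift[of "- x0" "0 :: real^2"] by (simp add: add.commute)
  show ?thesis
    by (simp add: germ_at_def cotangent_germ.abs_eq_iff * eventually_filtermap)
qed


section \<open>Integrals of the geodesic flow\<close>

definition hamiltonian :: "metric \<Rightarrow> real^2 \<Rightarrow> real^2 \<Rightarrow> real" where
  "hamiltonian g x p = (\<Sum>i\<in>UNIV. \<Sum>j\<in>UNIV. matrix_inv (g x) $ i $ j * p $ i * p $ j)"

definition poisson_bracket ::
    "(real^2 \<Rightarrow> real^2 \<Rightarrow> real) \<Rightarrow> (real^2 \<Rightarrow> real^2 \<Rightarrow> real) \<Rightarrow> real^2 \<Rightarrow> real^2 \<Rightarrow> real" where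
  "poisson_bracket F G x p =
     (\<Sum>i\<in>UNIV. pd i (\<lambda>y. F y p) x * pd i (G x) p - pd i (F x) p * pd i (\<lambda>y. G y p) x)"

definition homogeneous_integral_on ::
    "metric \<Rightarrow> (real^2) set \<Rightarrow> nat \<Rightarrow> (real^2 \<Rightarrow> real^2 \<Rightarrow> real) \<Rightarrow> bool" where
  "homogeneous_integral_on g U n F \<longleftrightarrow>
     (\<exists>u. (\<forall>i j. i + j = n \<longrightarrow> smooth_on U (u i j)) \<and>
          (\<forall>x\<in>U. \<forall>p. F x p = (\<Sum>(i, j) | i + j = n. u i j x * p $ 1 ^ i * p $ 2 ^ j))) \<and>
     (\<forall>x\<in>U. \<forall>p. poisson_bracket (hamiltonian g) F x p = 0)"

definition integral_germs :: "metric \<Rightarrow> real^2 \<Rightarrow> nat \<Rightarrow> cotangent_germ set" where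
  "integral_germs g x0 n =
     {germ_at x0 F |F. \<exists>U. open U \<and> x0 \<in> U \<and> homogeneous_integral_on g U n F}"

definition liouville_near :: "metric \<Rightarrow> real^2 \<Rightarrow> bool" where
  "liouville_near g x0 \<longleftrightarrow>
     (\<exists>\<Phi>\<in>integral_germs g x0 2. \<forall>r. \<Phi> \<noteq> r *\<^sub>R germ_at x0 (hamiltonian g))"

end

theory Submission
  imports Defs
begin

text \<open>At \<open>p\<^sub>0\<close> the gradient of \<open>K\<close> cannot vanish, so \<open>X = grad K / n\<close>, \<open>n = |grad K|\<close>, and its
  rotation \<open>Y\<close> form an orthonormal frame. \<open>I4b = 0\<close> says that \<open>X\<close> is geodesic, whence
  \<open>[X, Y] = - \<kappa> Y\<close> and \<open>X \<kappa> = - K - \<kappa>\<^sup>2\<close> with \<open>\<kappa>\<close> the geodesic curvature of the level curves of \<open>K\<close>,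
  and \<open>I5d = n\<^sup>4 \<nu>\<close> with \<open>\<nu> = Y \<kappa>\<close>.
  Writing a quadratic integral as \<open>A p\<^sub>X\<^sup>2 + 2 B p\<^sub>X p\<^sub>Y + C p\<^sub>Y\<^sup>2\<close>, the Killing equations prolong to a
  closed system for \<open>A, B, D = C - A, P = X B, Q = Y B, R = Y P\<close>, whose integrability condition is
  \<open>P = \<beta> B\<close> with \<open>\<beta> = (\<kappa> - X n / n) / 5\<close>. Differentiating it along \<open>X\<close> gives \<open>J5 B = 0\<close>, and twice
  along \<open>Y\<close> gives a relation that reads \<open>J4 B = 0\<close> wherever \<open>\<nu> = 0\<close>. Together they force \<open>B = 0\<close>.
  Then \<open>A\<close> is constant, \<open>X D = 2 \<kappa> D\<close>, \<open>Y D = 0\<close> and \<open>\<nu> D = 0\<close>. So a point with \<open>\<nu> \<noteq> 0\<close> leaves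
  only multiples of the Hamiltonian, while for \<open>\<nu> = 0\<close> the equations for \<open>D\<close> are solvable by the
  Poincare lemma, with a one-dimensional solution space.\<close>

subsection \<open>Partial derivatives\<close>

lemma has_derivative_pd:
  assumes "f differentiable at x"
  shows "(f has_derivative (\<lambda>v. v $ 1 * pd 1 f x + v $ 2 * pd 2 f x)) (at x)"
proof -
  have d: "(f has_derivative frechet_derivative f (at x)) (at x)"
    using assms by (simp add: frechet_derivative_works)
  have "frechet_derivative f (at x) v = v $ 1 * pd 1 f x + v $ 2 * pd 2 f x" for v
  proof -
    have v: "v = v $ 1 *\<^sub>R axis 1 1 + v $ 2 *\<^sub>R axis 2 1"
      by (simp add: vec_eq_iff forall_2 axis_def)
    have lin: "linear (frechet_derivative f (at x))"
      using d has_derivative_linear by blast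
    show ?thesis
      by (subst v) (simp only: linear_add[OF lin] linear_cmul[OF lin] pd_def real_scaleR_def)
  qed
  with d show ?thesis by (metis (no_types, lifting) ext)
qed

lemma pd_eqI:
  assumes "(f has_derivative f') (at x)"
  shows "pd i f x = f' (axis i 1)"
  using frechet_derivative_at[OF assms] by (simp add: pd_def)

lemma pd_cong:
  assumes "open U" "x \<in> U" "\<And>y. y \<in> U \<Longrightarrow> f y = g y"
  shows "pd i f x = pd i g x"
proof -
  have "(f has_derivative D) (at x) \<longleftrightarrow> (g has_derivative D) (at x)" for D
    using has_derivative_transform_within_open[OF _ assms(1,2)] assms(3) by metis
  then show ?thesis by (simp add: pd_def frechet_derivative_def)
qed

lemma differentiable_cong_open:
  assumes "open U" "x \<in> U" "\<And>y. y \<in> U \<Longrightarrow> f y = g y" "f differentiable at x"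
  shows "g differentiable at x"
  using assms has_derivative_transform_within_open unfolding differentiable_def by metis

lemma pd_const [simp]: "pd i (\<lambda>x. c) x = 0"
  by (rule pd_eqI[where f' = "\<lambda>_. 0", THEN trans]) auto

lemma pd_add:
  assumes "f differentiable at x" "g differentiable at x"
  shows "pd i (\<lambda>x. f x + g x) x = pd i f x + pd i g x"
  by (rule pd_eqI[OF has_derivative_add, THEN trans])
    (use assms in \<open>auto simp: frechet_derivative_works pd_def\<close>)

lemma pd_diff:
  assumes "f differentiable at x" "g differentiable at x"
  shows "pd i (\<lambda>x. f x - g x) x = pd i f x - pd i g x"
  by (rule pd_eqI[OF has_derivative_diff, THEN trans])
    (use assms in \<open>auto simp: frechet_derivative_works pd_def\<close>)

lemma pd_minus:
  assumes "f differentiable at x"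
  shows "pd i (\<lambda>x. - f x) x = - pd i f x"
  by (rule pd_eqI[OF has_derivative_minus, THEN trans])
    (use assms in \<open>auto simp: frechet_derivative_works pd_def\<close>)

lemma pd_mult:
  assumes "f differentiable at x" "g differentiable at x"
  shows "pd i (\<lambda>x. f x * g x) x = pd i f x * g x + f x * pd i g x"
  by (rule pd_eqI[OF has_derivative_mult, THEN trans])
    (use assms in \<open>auto simp: frechet_derivative_works pd_def\<close>)

lemma pd_divide_const:
  assumes "f differentiable at x"
  shows "pd i (\<lambda>x. f x / c) x = pd i f x / c"
  using pd_mult[OF assms, of "\<lambda>x. inverse c" i] by (simp add: divide_inverse)

lemma pd_comp:
  assumes "f differentiable at x" "(h has_field_derivative h') (at (f x))"
  shows "(\<lambda>x. h (f x)) differentiable at x" "pd i (\<lambda>x. h (f x)) x = h' * pd i f x"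
proof -
  have "((\<lambda>x. h (f x)) has_derivative (\<lambda>v. h' * frechet_derivative f (at x) v)) (at x)"
    using has_derivative_compose[OF assms(1)[unfolded frechet_derivative_works]
        assms(2)[unfolded has_field_derivative_def]] .
  then show "(\<lambda>x. h (f x)) differentiable at x" "pd i (\<lambda>x. h (f x)) x = h' * pd i f x"
    by (auto simp: differentiable_def pd_def dest: pd_eqI)
qed

subsection \<open>Smooth functions\<close>

lemma smooth_on_differentiable: "smooth_on U f \<Longrightarrow> x \<in> U \<Longrightarrow> f differentiable at x"
  unfolding smooth_on_def by (metis foldr_Nil id_apply)

lemma pd_smooth:
  assumes "x \<in> U"
  shows "smooth_on U f \<Longrightarrow> smooth_on U g \<Longrightarrow> pd i (\<lambda>x. f x + g x) x = pd i f x + pd i g x"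
    and "smooth_on U f \<Longrightarrow> smooth_on U g \<Longrightarrow> pd i (\<lambda>x. f x - g x) x = pd i f x - pd i g x"
    and "smooth_on U f \<Longrightarrow> smooth_on U g \<Longrightarrow> pd i (\<lambda>x. f x * g x) x = pd i f x * g x + f x * pd i g x"
    and "smooth_on U f \<Longrightarrow> pd i (\<lambda>x. - f x) x = - pd i f x"
    and "smooth_on U f \<Longrightarrow> pd i (\<lambda>x. f x / c) x = pd i f x / c"
  using assms by (auto intro!: pd_add pd_diff pd_mult pd_minus pd_divide_const smooth_on_differentiable)

lemma smooth_on_pd [simp]:
  assumes "smooth_on U f"
  shows "smooth_on U (pd i f)"
  unfolding smooth_on_def
proof (intro allI ballI)
  fix js x assume "x \<in> U"
  then show "foldr pd js (pd i f) differentiable at x"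
    using assms[unfolded smooth_on_def, rule_format, of x "js @ [i]"] by simp
qed

lemma smooth_on_subset: "smooth_on U f \<Longrightarrow> V \<subseteq> U \<Longrightarrow> smooth_on V f"
  unfolding smooth_on_def by blast

lemma continuous_on_smooth: "smooth_on U f \<Longrightarrow> continuous_on U f"
  by (meson continuous_at_imp_continuous_on differentiable_imp_continuous_within
      smooth_on_differentiable)

lemma isCont_smooth: "smooth_on U f \<Longrightarrow> x \<in> U \<Longrightarrow> isCont f x"
  by (meson differentiable_imp_continuous_within smooth_on_differentiable)

text \<open>\<open>foldr pd\<close> applies the last index of the list first, so the list is split
  at its end; the other indices then act on a function already known to be smooth.\<close>

lemma smooth_onI_pd:
  assumes "\<And>x. x \<in> U \<Longrightarrow> f differentiable at x" "\<And>i. smooth_on U (pd i f)"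
  shows "smooth_on U f"
  unfolding smooth_on_def
proof (intro allI ballI)
  fix js x assume "x \<in> U"
  then show "foldr pd js f differentiable at x"
    using assms by (cases js rule: rev_cases) (auto simp: smooth_on_def)
qed

text \<open>All closure properties of \<open>smooth_on\<close> come from one coinduction: the closure
  \<open>smooth_closure U\<close> consists of differentiable functions and is stable under \<open>pd\<close>.\<close>

inductive smooth_closure :: "(real^2) set \<Rightarrow> (real^2 \<Rightarrow> real) \<Rightarrow> bool" for U where
  base: "smooth_on U f \<Longrightarrow> smooth_closure U f"
| cong: "smooth_closure U f \<Longrightarrow> (\<And>x. x \<in> U \<Longrightarrow> f x = g x) \<Longrightarrow> smooth_closure U g"
| const: "smooth_closure U (\<lambda>x. c)"
| add: "smooth_closure U f \<Longrightarrow> smooth_closure U g \<Longrightarrow> smooth_closure U (\<lambda>x. f x + g x)"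
| mult: "smooth_closure U f \<Longrightarrow> smooth_closure U g \<Longrightarrow> smooth_closure U (\<lambda>x. f x * g x)"
| inverse: "smooth_closure U f \<Longrightarrow> (\<And>x. x \<in> U \<Longrightarrow> f x \<noteq> 0) \<Longrightarrow> smooth_closure U (\<lambda>x. inverse (f x))"
| sqrt: "smooth_closure U f \<Longrightarrow> (\<And>x. x \<in> U \<Longrightarrow> f x > 0) \<Longrightarrow> smooth_closure U (\<lambda>x. sqrt (f x))"
| exp: "smooth_closure U f \<Longrightarrow> smooth_closure U (\<lambda>x. exp (f x))"

text \<open>The coinduction step: sum, product and chain rule write each derivative as a member of
  the closure. These formulas hold only at points of \<open>U\<close>, which is what the rule
  \<open>cong\<close> is for.\<close>

lemma smooth_closure_pd:
  assumes "open U" "smooth_closure U f"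
  shows "(\<forall>x\<in>U. f differentiable at x) \<and> (\<forall>i. smooth_closure U (pd i f))"
  using assms(2)
proof (induction rule: smooth_closure.induct)
  case (base f)
  then show ?case by (auto intro: smooth_closure.base smooth_on_differentiable)
next
  case (cong f g)
  have "smooth_closure U (pd i g)" for i
    by (rule smooth_closure.cong[of _ "pd i f"]) (use cong pd_cong[OF assms(1)] in blast)+
  with cong show ?case
    using differentiable_cong_open[OF assms(1)] by blast
next
  case (const c)
  then show ?case by (auto simp: pd_const[abs_def] intro: smooth_closure.const)
next
  case (add f g)
  have "smooth_closure U (pd i (\<lambda>x. f x + g x))" for i
    by (rule smooth_closure.cong[of _ "\<lambda>x. pd i f x + pd i g x"])
      (use add in \<open>auto simp: pd_add intro: smooth_closure.add\<close>)
  with add show ?case by auto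
next
  case (mult f g)
  have "smooth_closure U (pd i (\<lambda>x. f x * g x))" for i
    by (rule smooth_closure.cong[of _ "\<lambda>x. pd i f x * g x + f x * pd i g x"])
      (use mult in \<open>auto simp: pd_mult intro!: smooth_closure.add smooth_closure.mult\<close>)
  with mult show ?case by auto
next
  case (inverse f)
  \<comment> \<open>The derivative is spelled with products, so that the rules of the closure apply
    to it again.\<close>
  have d: "(inverse has_field_derivative (-1) * (inverse (f x) * inverse (f x))) (at (f x))"
    if "x \<in> U" for x
    using DERIV_inverse[of "f x"] inverse.hyps(2)[OF that] by (simp add: power2_eq_square)
  have "smooth_closure U (pd i (\<lambda>x. inverse (f x)))" for i
  proof (rule smooth_closure.cong[of _ "\<lambda>x. (-1) * (inverse (f x) * inverse (f x)) * pd i f x"])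
    show "smooth_closure U (\<lambda>x. (-1) * (inverse (f x) * inverse (f x)) * pd i f x)"
      using inverse.IH inverse.hyps
      by (intro smooth_closure.mult smooth_closure.const smooth_closure.inverse) auto
  qed (use inverse pd_comp(2)[where h = inverse, OF _ d] in auto)
  with inverse pd_comp(1)[OF _ d] show ?case by auto
next
  case (sqrt f)
  have d: "(sqrt has_field_derivative inverse (2 * sqrt (f x))) (at (f x))"
    if "x \<in> U" for x
    using DERIV_real_sqrt[of "f x"] sqrt.hyps(2)[OF that] by (simp add: field_simps)
  have "smooth_closure U (pd i (\<lambda>x. sqrt (f x)))" for i
  proof (rule smooth_closure.cong[of _ "\<lambda>x. inverse (2 * sqrt (f x)) * pd i f x"])
    show "smooth_closure U (\<lambda>x. inverse (2 * sqrt (f x)) * pd i f x)"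
      using sqrt.IH sqrt.hyps
      by (intro smooth_closure.mult smooth_closure.inverse smooth_closure.const smooth_closure.sqrt)
        force+
  qed (use sqrt pd_comp(2)[OF _ d] in auto)
  with sqrt pd_comp(1)[OF _ d] show ?case by auto
next
  case (exp f)
  have "smooth_closure U (pd i (\<lambda>x. exp (f x)))" for i
    by (rule smooth_closure.cong[of _ "\<lambda>x. exp (f x) * pd i f x"])
      (use exp pd_comp(2)[OF _ DERIV_exp] in
        \<open>auto intro!: smooth_closure.mult smooth_closure.exp\<close>)
  with exp pd_comp(1)[OF _ DERIV_exp] show ?case by auto
qed

lemma smooth_closure_iff:
  assumes "open U"
  shows "smooth_closure U f \<longleftrightarrow> smooth_on U f"
proof
  assume f: "smooth_closure U f"
  have "smooth_closure U (foldr pd is f)" for "is"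
    using f smooth_closure_pd[OF assms] by (induction "is") auto
  then show "smooth_on U f"
    using smooth_closure_pd[OF assms] by (auto simp: smooth_on_def)
qed (rule smooth_closure.base)

context
  fixes U :: "(real^2) set"
  assumes U: "open U"
begin

lemma smooth_on_cong: "smooth_on U f \<Longrightarrow> (\<And>x. x \<in> U \<Longrightarrow> f x = g x) \<Longrightarrow> smooth_on U g"
  using smooth_closure.cong[of U f g] by (simp add: smooth_closure_iff[OF U])

lemma smooth_on_const: "smooth_on U (\<lambda>x. c)"
  using smooth_closure.const[where U=U] by (simp add: smooth_closure_iff[OF U])

lemma smooth_on_add: "smooth_on U f \<Longrightarrow> smooth_on U g \<Longrightarrow> smooth_on U (\<lambda>x. f x + g x)"
  using smooth_closure.add[where U=U] by (simp add: smooth_closure_iff[OF U])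

lemma smooth_on_mult: "smooth_on U f \<Longrightarrow> smooth_on U g \<Longrightarrow> smooth_on U (\<lambda>x. f x * g x)"
  using smooth_closure.mult[where U=U] by (simp add: smooth_closure_iff[OF U])

lemma smooth_on_inverse:
  "smooth_on U f \<Longrightarrow> (\<And>x. x \<in> U \<Longrightarrow> f x \<noteq> 0) \<Longrightarrow> smooth_on U (\<lambda>x. inverse (f x))"
  using smooth_closure.inverse[where U=U] by (simp add: smooth_closure_iff[OF U])

lemma smooth_on_sqrt:
  "smooth_on U f \<Longrightarrow> (\<And>x. x \<in> U \<Longrightarrow> f x > 0) \<Longrightarrow> smooth_on U (\<lambda>x. sqrt (f x))"
  using smooth_closure.sqrt[where U=U] by (simp add: smooth_closure_iff[OF U])

lemma smooth_on_exp: "smooth_on U f \<Longrightarrow> smooth_on U (\<lambda>x. exp (f x))"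
  using smooth_closure.exp[where U=U] by (simp add: smooth_closure_iff[OF U])

lemma smooth_on_minus: "smooth_on U f \<Longrightarrow> smooth_on U (\<lambda>x. - f x)"
  using smooth_on_mult[OF smooth_on_const[of "-1"]] by simp

lemma smooth_on_diff: "smooth_on U f \<Longrightarrow> smooth_on U g \<Longrightarrow> smooth_on U (\<lambda>x. f x - g x)"
  using smooth_on_add[OF _ smooth_on_minus] by fastforce

lemma smooth_on_divide:
  "smooth_on U f \<Longrightarrow> smooth_on U g \<Longrightarrow> (\<And>x. x \<in> U \<Longrightarrow> g x \<noteq> 0) \<Longrightarrow> smooth_on U (\<lambda>x. f x / g x)"
  unfolding divide_inverse by (intro smooth_on_mult smooth_on_inverse)

lemma smooth_on_divide_const: "smooth_on U f \<Longrightarrow> smooth_on U (\<lambda>x. f x / c)"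
  unfolding divide_inverse by (intro smooth_on_mult smooth_on_const)

lemma smooth_on_power: "smooth_on U f \<Longrightarrow> smooth_on U (\<lambda>x. f x ^ n)"
  by (induction n) (auto intro: smooth_on_const smooth_on_mult)

lemmas smooth_on_simps = smooth_on_const smooth_on_add smooth_on_mult smooth_on_exp
  smooth_on_minus smooth_on_diff smooth_on_divide_const smooth_on_power

end

text \<open>Reduces questions on the plane to one real variable. Leaving \<open>S\<close> arbitrary
  covers one-sided derivatives at the ends of an interval.\<close>

lemma has_derivative_along_line:
  assumes "f differentiable at (c + t *\<^sub>R v)"
  shows "((\<lambda>t. f (c + t *\<^sub>R v)) has_real_derivative
    v $ 1 * pd 1 f (c + t *\<^sub>R v) + v $ 2 * pd 2 f (c + t *\<^sub>R v)) (at t within S)"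
proof -
  have "((\<lambda>t. c + t *\<^sub>R v) has_derivative (\<lambda>s. s *\<^sub>R v)) (at t within S)"
    by (auto intro!: derivative_eq_intros)
  from has_derivative_compose[OF this has_derivative_pd[OF assms]]
  show ?thesis
    unfolding has_field_derivative_def
    by (rule has_derivative_eq_rhs) (auto simp: fun_eq_iff algebra_simps)
qed

lemma has_derivative_along_axis:
  assumes "f differentiable at (c + t *\<^sub>R axis i 1)"
  shows "((\<lambda>t. f (c + t *\<^sub>R axis i 1)) has_real_derivative pd i f (c + t *\<^sub>R axis i 1))
    (at t within S)"
  using has_derivative_along_line[OF assms] exhaust_2[of i] by (auto simp: axis_def)

subsection \<open>Symmetry of second derivatives\<close>

text \<open>The mean value theorem is used twice: in direction \<open>i\<close> for the difference
  of \<open>f\<close> across a step in direction \<open>j\<close>, then in direction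
  \<open>j\<close> for \<open>pd i f\<close>. The second difference on the left is symmetric in
  \<open>i\<close> and \<open>j\<close>.\<close>

lemma second_difference_mean_value:
  assumes U: "ball x r \<subseteq> U" and f: "smooth_on U f" and h: "0 < h" "2 * h < r"
  shows "\<exists>s\<in>{0..h}. \<exists>t\<in>{0..h}. f (x + h *\<^sub>R axis i 1 + h *\<^sub>R axis j 1) - f (x + h *\<^sub>R axis i 1)
     - f (x + h *\<^sub>R axis j 1) + f x = h * h * pd j (pd i f) (x + s *\<^sub>R axis i 1 + t *\<^sub>R axis j 1)"
proof -
  define p where "p s t = x + s *\<^sub>R axis i 1 + t *\<^sub>R axis j 1" for s t
  have pU: "p s t \<in> U" if "s \<in> {0..h}" "t \<in> {0..h}" for s t
  proof -
    have "norm (s *\<^sub>R axis i 1 + t *\<^sub>R axis j 1 :: real^2) \<le> s + t"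
      using that by (intro norm_triangle_le) (auto simp: norm_axis_1)
    moreover have "p s t - x = s *\<^sub>R axis i 1 + t *\<^sub>R axis j 1"
      by (simp add: p_def)
    ultimately have "p s t \<in> ball x r"
      using that h by (simp only: mem_ball dist_norm norm_minus_commute[of x] atLeastAtMost_iff) linarith
    then show ?thesis using U by blast
  qed
  have d1: "((\<lambda>s. u (p s t)) has_real_derivative pd i u (p s t)) (at s within S)"
    if "smooth_on U u" "s \<in> {0..h}" "t \<in> {0..h}" for u s t S
    using has_derivative_along_axis[of u "x + t *\<^sub>R axis j 1" s i S]
      smooth_on_differentiable[OF that(1) pU[OF that(2,3)]]
    by (simp add: p_def ac_simps)
  have d2: "((\<lambda>t. u (p s t)) has_real_derivative pd j u (p s t)) (at t within S)"
    if "smooth_on U u" "s \<in> {0..h}" "t \<in> {0..h}" for u s t S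
    using has_derivative_along_axis[of u "x + s *\<^sub>R axis i 1" t j S]
      smooth_on_differentiable[OF that(1) pU[OF that(2,3)]]
    by (simp add: p_def)
  have "\<exists>s. 0 < s \<and> s < h \<and> (f (p h h) - f (p h 0)) - (f (p 0 h) - f (p 0 0))
      = (h - 0) * (pd i f (p s h) - pd i f (p s 0))"
    using h by (intro MVT2) (auto intro!: DERIV_diff d1[OF f])
  then obtain s where s: "0 < s" "s < h"
    "(f (p h h) - f (p h 0)) - (f (p 0 h) - f (p 0 0)) = h * (pd i f (p s h) - pd i f (p s 0))"
    by auto
  have "\<exists>t. 0 < t \<and> t < h \<and> pd i f (p s h) - pd i f (p s 0) = (h - 0) * pd j (pd i f) (p s t)"
    using h s by (intro MVT2) (auto intro!: d2 smooth_on_pd[OF f])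
  then obtain t where t: "0 < t" "t < h" "pd i f (p s h) - pd i f (p s 0) = h * pd j (pd i f) (p s t)"
    by auto
  show ?thesis
    using s t by (intro bexI[of _ s] bexI[of _ t]) (auto simp: p_def)
qed

text \<open>By the symmetry of the second difference, the two mixed derivatives share a value, taken
  at points within \<open>2 * h\<close> of \<open>x\<close>; their continuity at \<open>x\<close>
  does the rest.\<close>

lemma pd_commute:
  assumes "open U" "smooth_on U f" "x \<in> U"
  shows "pd i (pd j f) x = pd j (pd i f) x"
proof (rule ccontr)
  assume ne: "pd i (pd j f) x \<noteq> pd j (pd i f) x"
  define e where "e = \<bar>pd i (pd j f) x - pd j (pd i f) x\<bar> / 2"
  have e: "e > 0" using ne by (simp add: e_def)
  \<comment> \<open>With \<open>e\<close> half the gap, a number cannot lie within \<open>e\<close>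
    of both mixed derivatives at \<open>x\<close>.\<close>
  obtain r where r: "r > 0" "ball x r \<subseteq> U" using assms openE by blast
  have c: "\<exists>d>0. \<forall>y. dist y x < d \<longrightarrow> dist (pd k (pd l f) y) (pd k (pd l f) x) < e" for k l
    using isCont_smooth[of U "pd k (pd l f)" x] assms e
    unfolding continuous_at_eps_delta by simp
  obtain d1 where d1: "d1 > 0" "\<And>y. dist y x < d1 \<Longrightarrow> dist (pd i (pd j f) y) (pd i (pd j f) x) < e"
    using c by metis
  obtain d2 where d2: "d2 > 0" "\<And>y. dist y x < d2 \<Longrightarrow> dist (pd j (pd i f) y) (pd j (pd i f) x) < e"
    using c by metis
  define h where "h = min r (min d1 d2) / 3"
  have h: "0 < h" "2 * h < r" "2 * h < d1" "2 * h < d2"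
    using r d1 d2 by (auto simp: h_def min_def)
  have near: "dist (x + s *\<^sub>R axis k 1 + t *\<^sub>R axis l 1) x \<le> 2 * h"
    if "s \<in> {0..h}" "t \<in> {0..h}" for s t k l
  proof -
    have "norm (s *\<^sub>R axis k 1 + t *\<^sub>R axis l 1 :: real^2) \<le> s + t"
      using that by (intro norm_triangle_le) (auto simp: norm_axis_1)
    then show ?thesis using that by (auto simp: dist_norm add.assoc)
  qed
  obtain s t where st: "s \<in> {0..h}" "t \<in> {0..h}"
    and 1: "f (x + h *\<^sub>R axis i 1 + h *\<^sub>R axis j 1) - f (x + h *\<^sub>R axis i 1)
     - f (x + h *\<^sub>R axis j 1) + f x = h * h * pd j (pd i f) (x + s *\<^sub>R axis i 1 + t *\<^sub>R axis j 1)"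
    using second_difference_mean_value[OF r(2) assms(2) h(1,2)] by metis
  obtain s' t' where st': "s' \<in> {0..h}" "t' \<in> {0..h}"
    and 2: "f (x + h *\<^sub>R axis j 1 + h *\<^sub>R axis i 1) - f (x + h *\<^sub>R axis j 1)
     - f (x + h *\<^sub>R axis i 1) + f x = h * h * pd i (pd j f) (x + s' *\<^sub>R axis j 1 + t' *\<^sub>R axis i 1)"
    using second_difference_mean_value[OF r(2) assms(2) h(1,2)] by metis
  have "pd j (pd i f) (x + s *\<^sub>R axis i 1 + t *\<^sub>R axis j 1)
      = pd i (pd j f) (x + s' *\<^sub>R axis j 1 + t' *\<^sub>R axis i 1)"
    using 1 2 h(1) by (simp add: add.assoc add.commute[of "h *\<^sub>R axis j 1"] algebra_simps)
  moreover have "dist (pd j (pd i f) (x + s *\<^sub>R axis i 1 + t *\<^sub>R axis j 1)) (pd j (pd i f) x) < e"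
    using near[OF st] h by (intro d2(2)) (meson le_less_trans)
  moreover have "dist (pd i (pd j f) (x + s' *\<^sub>R axis j 1 + t' *\<^sub>R axis i 1)) (pd i (pd j f) x) < e"
    using near[OF st'] h by (intro d1(2)) (meson le_less_trans)
  ultimately show False
    unfolding e_def dist_real_def by (smt (verit) field_sum_of_halves)
qed

subsection \<open>Functions with prescribed gradient\<close>

lemma pd_zero_imp_constant:
  assumes "convex W" "open W" "\<And>x. x \<in> W \<Longrightarrow> f differentiable at x"
    and "\<And>i x. x \<in> W \<Longrightarrow> pd i f x = 0" "x \<in> W" "y \<in> W"
  shows "f x = f y"
proof (rule has_derivative_zero_unique[OF assms(1) _ assms(5,6)])
  fix z assume z: "z \<in> W"
  show "(f has_derivative (\<lambda>h. 0)) (at z within W)"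
    using has_derivative_pd[OF assms(3)[OF z]] assms(4)[OF z] by (simp add: has_derivative_at_withinI)
qed

text \<open>Integrating factor: with \<open>b\<close> an antiderivative of \<open>a\<close>, the
  product of \<open>f\<close> and \<open>exp (- b)\<close> has derivative zero.\<close>

lemma linear_ode_on_interval_zero:
  fixes f a :: "real \<Rightarrow> real"
  assumes "continuous_on {0..1} a"
    and "\<And>t. t \<in> {0..1} \<Longrightarrow> (f has_real_derivative a t * f t) (at t within {0..1})"
    and "f 0 = 0" and "s \<in> {0..1}"
  shows "f s = 0"
proof -
  obtain b where b: "\<And>t. t \<in> {0..1} \<Longrightarrow> (b has_real_derivative a t) (at t within {0..1})"
    using antiderivative_continuous[OF assms(1)] unfolding has_real_derivative_iff_has_vector_derivative
    by metis
  have "((\<lambda>t. f t * exp (- b t)) has_derivative (\<lambda>h. 0)) (at t within {0..1})"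
    if t: "t \<in> {0..1}" for t
  proof -
    have "((\<lambda>t. f t * exp (- b t)) has_real_derivative 0) (at t within {0..1})"
      using assms(2)[OF t] b[OF t]
      by (auto intro!: derivative_eq_intros)
    then show ?thesis by (simp add: has_field_derivative_def lambda_zero)
  qed
  from has_derivative_zero_unique[OF _ this, of 0 s] show ?thesis
    using assms by simp
qed

text \<open>Along each segment the hypothesis is a linear ODE for \<open>f\<close>.\<close>

lemma log_gradient_zero:
  assumes "convex W" "open W" "smooth_on W f" "smooth_on W a" "smooth_on W b"
    and "\<And>x. x \<in> W \<Longrightarrow> pd 1 f x = a x * f x" "\<And>x. x \<in> W \<Longrightarrow> pd 2 f x = b x * f x"
    and "c \<in> W" "f c = 0" "x \<in> W"
  shows "f x = 0"
proof -
  define v where "v = x - c"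
  have W: "c + t *\<^sub>R v \<in> W" if "t \<in> {0..1}" for t
    using convexD_alt[OF assms(1,8,10), of t] that by (simp add: v_def algebra_simps)
  have line: "continuous_on {0..1} (\<lambda>t. u (c + t *\<^sub>R v))" if "smooth_on W u" for u
    by (rule continuous_on_compose2[OF continuous_on_smooth[OF that]])
      (use W in \<open>auto intro!: continuous_intros\<close>)
  have "f (c + 1 *\<^sub>R v) = 0"
  proof (rule linear_ode_on_interval_zero[where s = 1 and f = "\<lambda>t. f (c + t *\<^sub>R v)"
        and a = "\<lambda>t. v $ 1 * a (c + t *\<^sub>R v) + v $ 2 * b (c + t *\<^sub>R v)"])
    show "continuous_on {0..1} (\<lambda>t. v $ 1 * a (c + t *\<^sub>R v) + v $ 2 * b (c + t *\<^sub>R v))"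
      by (intro continuous_intros line assms)
    show "((\<lambda>t. f (c + t *\<^sub>R v)) has_real_derivative
        (v $ 1 * a (c + t *\<^sub>R v) + v $ 2 * b (c + t *\<^sub>R v)) * f (c + t *\<^sub>R v)) (at t within {0..1})"
      if "t \<in> {0..1}" for t
      using has_derivative_along_line[OF smooth_on_differentiable[OF assms(3) W[OF that]]]
      by (simp add: assms(6,7) W[OF that] algebra_simps)
  qed (use assms in auto)
  then show ?thesis by (simp add: v_def)
qed

text \<open>The potential is the integral of the 1-form with components \<open>a\<close>,
  \<open>b\<close> along the segments from the centre, differentiated under the integral
  sign.\<close>

lemma poincare_lemma_ball:
  assumes a: "smooth_on (ball c r) a" and b: "smooth_on (ball c r) b"
    and closed: "\<And>x. x \<in> ball c r \<Longrightarrow> pd 1 b x = pd 2 a x"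
  obtains h where "smooth_on (ball c r) h"
    and "\<And>x. x \<in> ball c r \<Longrightarrow> pd 1 h x = a x" "\<And>x. x \<in> ball c r \<Longrightarrow> pd 2 h x = b x"
proof -
  define W where "W = ball c r"
  define l where "l x t = c + t *\<^sub>R (x - c)" for x t
  have lW: "l x t \<in> W" if "x \<in> W" "t \<in> {0..1}" for x t
  proof -
    have "norm (t *\<^sub>R (x - c)) \<le> norm (x - c)"
      using that by (simp add: mult_left_le_one_le)
    then show ?thesis
      using that by (simp add: l_def W_def dist_norm norm_minus_commute)
  qed
  have ab: "smooth_on W a" "smooth_on W b" using a b by (simp_all add: W_def)
  define f where "f x t = (x - c) $ 1 * a (l x t) + (x - c) $ 2 * b (l x t)" for x t
  define h where "h x = integral (cbox 0 1) (f x)" for x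
  \<comment> \<open>\<open>G i\<close> is the partial derivative of the integrand \<open>f\<close>
    in direction \<open>i\<close>; \<open>F\<close> packs both into the bounded linear map that the
    Leibniz rule asks for.\<close>
  define G where "G i x t = (if i = 1 then a (l x t) else b (l x t))
      + t * ((x - c) $ 1 * pd i a (l x t) + (x - c) $ 2 * pd i b (l x t))" for i :: 2 and x t
  define F where "F x t = G 1 x t *\<^sub>R blinfun_inner_right (axis 1 1) +
      G 2 x t *\<^sub>R blinfun_inner_right (axis 2 1 :: real^2)" for x t
  have F_apply: "blinfun_apply (F x t) v = G 1 x t * v $ 1 + G 2 x t * v $ 2" for x t v
    by (simp add: F_def blinfun.add_left blinfun.scaleR_left inner_axis')
  have cont: "continuous_on (W \<times> {0..1}) (\<lambda>z. u (l (fst z) (snd z)))" if "smooth_on W u" for u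
    by (rule continuous_on_compose2[OF continuous_on_smooth[OF that]])
      (use lW in \<open>auto simp: l_def intro!: continuous_intros\<close>)
  have cont_G: "continuous_on (W \<times> {0..1}) (\<lambda>z. G i (fst z) (snd z))" for i
    unfolding G_def using ab by (cases "i = 1") (auto intro!: continuous_intros cont)
  have cont_F: "continuous_on (W \<times> {0..1}) (\<lambda>(x, t). F x t)"
    unfolding F_def split_beta by (intro continuous_intros cont_G)
  have cont_f: "continuous_on (W \<times> {0..1}) (\<lambda>z. f (fst z) (snd z))"
    unfolding f_def using ab by (intro continuous_intros cont)
  have slice: "continuous_on {0..1} (\<lambda>t. u x t)"
    if "continuous_on (W \<times> {0..1}) (\<lambda>z. u (fst z) (snd z))" "x \<in> W"
    for x and u :: "real^2 \<Rightarrow> real \<Rightarrow> 'z::topological_space"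
  proof -
    have "continuous_on {0..1} (\<lambda>t. u (fst (x, t)) (snd (x, t)))"
      by (rule continuous_on_compose2[OF that(1)]) (use that(2) in \<open>auto intro!: continuous_intros\<close>)
    then show ?thesis by simp
  qed
  have df: "((\<lambda>x. f x t) has_derivative blinfun_apply (F x t)) (at x within W)"
    if "x \<in> W" "t \<in> {0..1}" for x t
  proof -
    have dl: "((\<lambda>x. l x t) has_derivative (\<lambda>v. t *\<^sub>R v)) (at x within W)"
      unfolding l_def by (auto intro!: derivative_eq_intros)
    have du: "((\<lambda>x. u (l x t)) has_derivative
        (\<lambda>v. t * (v $ 1 * pd 1 u (l x t) + v $ 2 * pd 2 u (l x t)))) (at x within W)"
      if "smooth_on W u" for u
      using has_derivative_compose[OF dl has_derivative_pd[OF smooth_on_differentiable[OF that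
            lW[OF \<open>x \<in> W\<close> \<open>t \<in> {0..1}\<close>]]]]
      by (simp add: algebra_simps)
    have dy: "((\<lambda>x. (x - c) $ i) has_derivative (\<lambda>v. v $ i)) (at x within W)" for i
      using bounded_linear.has_derivative[OF bounded_linear_vec_nth[of i]
          has_derivative_diff[OF has_derivative_ident has_derivative_const]] by simp
    show ?thesis
      unfolding f_def
      by (rule has_derivative_eq_rhs[OF has_derivative_add[OF
            has_derivative_mult[OF dy du[OF ab(1)]] has_derivative_mult[OF dy du[OF ab(2)]]]])
        (auto simp: fun_eq_iff F_apply G_def algebra_simps)
  qed
  have dh: "(h has_derivative (\<lambda>v. integral {0..1} (G 1 x) * v $ 1 + integral {0..1} (G 2 x) * v $ 2)) (at x)"
    if x: "x \<in> W" for x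
  proof -
    have G_int: "G i x integrable_on {0..1}" for i
      using integrable_continuous_real[OF slice[of "\<lambda>x t. G i x t", OF cont_G x]] by simp
    have F_int: "F x integrable_on {0..1}"
      using integrable_continuous_real[OF slice[of F, OF _ x]] cont_F by (simp add: split_beta)
    have dF: "(h has_derivative integral (cbox 0 1) (F x)) (at x within W)"
      unfolding h_def
    proof (rule leibniz_rule[where f = f and fx = F])
      show "f x integrable_on cbox 0 1" if "x \<in> W" for x
        using integrable_continuous_real[OF slice[of f, OF cont_f that]] by simp
    qed (use df x cont_F in \<open>auto simp: W_def\<close>)
    have val: "integral (cbox 0 1) (F x) v
        = integral {0..1} (G 1 x) * v $ 1 + integral {0..1} (G 2 x) * v $ 2" for v
    proof -
      have "integral (cbox 0 1) (F x) v = integral {0..1} (\<lambda>t. F x t v)"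
        using integral_linear[OF F_int, of "\<lambda>f. blinfun_apply f v"]
        by (simp add: o_def blinfun.bounded_linear_left)
      also have "\<dots> = integral {0..1} (\<lambda>t. G 1 x t * v $ 1 + G 2 x t * v $ 2)"
        by (simp add: F_apply)
      also have "\<dots> = integral {0..1} (G 1 x) * v $ 1 + integral {0..1} (G 2 x) * v $ 2"
        by (subst integral_add) (auto intro!: integrable_on_mult_left G_int)
      finally show ?thesis .
    qed
    have "blinfun_apply (integral (cbox 0 1) (F x))
        = (\<lambda>v. integral {0..1} (G 1 x) * v $ 1 + integral {0..1} (G 2 x) * v $ 2)"
      by (rule ext) (rule val)
    with dF have "(h has_derivative
        (\<lambda>v. integral {0..1} (G 1 x) * v $ 1 + integral {0..1} (G 2 x) * v $ 2)) (at x within W)"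
      by (simp only:)
    then show ?thesis
      using x at_within_open[of x W] by (simp add: W_def)
  qed
  \<comment> \<open>Closedness makes \<open>G i x\<close> the derivative of
    \<open>t * u (l x t)\<close>, which integrates to the value of \<open>u\<close> at
    \<open>x\<close>.\<close>
  have int_G: "integral {0..1} (G i x) = (if i = 1 then a x else b x)" if x: "x \<in> W" for i x
  proof -
    define u where "u = (if i = 1 then a else b)"
    have u: "smooth_on W u" using ab by (simp add: u_def)
    have "((\<lambda>t. G i x t) has_integral (1 * u (l x 1) - 0 * u (l x 0))) {0..1}"
    proof (rule fundamental_theorem_of_calculus)
      fix t :: real assume t: "t \<in> {0..1}"
      have "((\<lambda>t. t * u (l x t)) has_real_derivative u (l x t) + t *
          ((x - c) $ 1 * pd 1 u (l x t) + (x - c) $ 2 * pd 2 u (l x t))) (at t within {0..1})"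
        using has_derivative_along_line[OF smooth_on_differentiable[OF u lW[OF x t, unfolded l_def]]]
        unfolding l_def by (auto intro!: derivative_eq_intros)
      moreover have "pd i a (l x t) = pd 1 u (l x t)" "pd i b (l x t) = pd 2 u (l x t)"
        using closed[of "l x t"] lW[OF x t] exhaust_2[of i] by (auto simp: u_def W_def)
      ultimately have "((\<lambda>t. t * u (l x t)) has_real_derivative G i x t) (at t within {0..1})"
        by (cases "i = 1") (simp_all add: G_def u_def)
      then show "((\<lambda>t. t * u (l x t)) has_vector_derivative G i x t) (at t within {0..1})"
        by (rule has_real_derivative_iff_has_vector_derivative[THEN iffD1])
    qed simp
    then have "integral {0..1} (\<lambda>t. G i x t) = 1 * u (l x 1) - 0 * u (l x 0)"
      by (rule integral_unique)
    then show ?thesis by (simp add: l_def u_def)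
  qed
  have pd_h: "pd 1 h x = a x" "pd 2 h x = b x" if "x \<in> W" for x
    using pd_eqI[OF dh[OF that]] int_G[OF that] by (auto simp: axis_def)
  have "smooth_on W h"
  proof (rule smooth_onI_pd)
    show "h differentiable at x" if "x \<in> W" for x
      using dh[OF that] by (auto simp: differentiable_def)
    have oW: "open W" by (simp add: W_def)
    have "smooth_on W (pd 1 h)" "smooth_on W (pd 2 h)"
      using smooth_on_cong[OF oW ab(1), of "pd 1 h"] smooth_on_cong[OF oW ab(2), of "pd 2 h"] pd_h
      by simp_all
    then show "smooth_on W (pd i h)" for i
      using exhaust_2[of i] by auto
  qed
  with pd_h show ?thesis
    by (intro that) (simp_all add: W_def)
qed

subsection \<open>Adapted frames\<close>

definition along :: "(real^2 \<Rightarrow> real^2) \<Rightarrow> (real^2 \<Rightarrow> real) \<Rightarrow> real^2 \<Rightarrow> real" where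
  "along V f x = V x $ 1 * pd 1 f x + V x $ 2 * pd 2 f x"

lemma along_cong:
  assumes "open U" "x \<in> U" "\<And>y. y \<in> U \<Longrightarrow> f y = g y"
  shows "along V f x = along V g x"
  unfolding along_def using pd_cong[OF assms] by simp

lemma along_smooth:
  assumes "x \<in> U"
  shows "smooth_on U f \<Longrightarrow> smooth_on U g \<Longrightarrow> along V (\<lambda>x. f x + g x) x = along V f x + along V g x"
    and "smooth_on U f \<Longrightarrow> smooth_on U g \<Longrightarrow> along V (\<lambda>x. f x - g x) x = along V f x - along V g x"
    and "smooth_on U f \<Longrightarrow> smooth_on U g \<Longrightarrow>
      along V (\<lambda>x. f x * g x) x = along V f x * g x + f x * along V g x"
    and "smooth_on U f \<Longrightarrow> along V (\<lambda>x. - f x) x = - along V f x"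
    and "smooth_on U f \<Longrightarrow> along V (\<lambda>x. f x / c) x = along V f x / c"
    and "along V (\<lambda>x. c) x = 0"
  using assms by (simp_all add: along_def pd_smooth[where U = U] algebra_simps add_divide_distrib)

text \<open>The second-order terms cancel by symmetry of second derivatives; the derivative along
  the Lie bracket is left.\<close>

lemma along_along_commute:
  assumes U: "open U" "smooth_on U f" "x \<in> U"
    and [simp]: "\<And>i. smooth_on U (\<lambda>x. V x $ i)" "\<And>i. smooth_on U (\<lambda>x. V' x $ i)"
  shows "along V (along V' f) x - along V' (along V f) x
      = (along V (\<lambda>x. V' x $ 1) x - along V' (\<lambda>x. V x $ 1) x) * pd 1 f x
      + (along V (\<lambda>x. V' x $ 2) x - along V' (\<lambda>x. V x $ 2) x) * pd 2 f x"
proof -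
  have *: "along V (along Z f) x = along V (\<lambda>x. Z x $ 1) x * pd 1 f x + along V (\<lambda>x. Z x $ 2) x * pd 2 f x
      + V x $ 1 * Z x $ 1 * pd 1 (pd 1 f) x + V x $ 1 * Z x $ 2 * pd 1 (pd 2 f) x
      + V x $ 2 * Z x $ 1 * pd 1 (pd 2 f) x + V x $ 2 * Z x $ 2 * pd 2 (pd 2 f) x"
    if [simp]: "\<And>i. smooth_on U (\<lambda>x. Z x $ i)" for V Z
    using pd_commute[OF U, of 2 1] U(2,3)
    by (simp add: along_def[abs_def] pd_smooth[where U = U] smooth_on_simps[OF U(1)] algebra_simps)
  show ?thesis
    by (simp add: * algebra_simps)
qed

text \<open>An orthonormal frame \<open>X\<close>, \<open>Y\<close> whose first vector is geodesic and is the direction of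
  \<open>grad K\<close>: \<open>\<kappa>\<close> is the geodesic curvature of the level curves of \<open>K\<close>.\<close>

locale adapted_frame =
  fixes W :: "(real^2) set" and X Y :: "real^2 \<Rightarrow> real^2" and \<kappa> K n :: "real^2 \<Rightarrow> real"
  assumes open_W: "open W"
    and smooth_frame [simp]: "smooth_on W (\<lambda>x. X x $ i)" "smooth_on W (\<lambda>x. Y x $ i)"
    and smooth_coeffs [simp]: "smooth_on W \<kappa>" "smooth_on W K" "smooth_on W n"
    and frame_det: "x \<in> W \<Longrightarrow> X x $ 1 * Y x $ 2 - X x $ 2 * Y x $ 1 \<noteq> 0"
    and frame_bracket: "x \<in> W \<Longrightarrow>
      along X (\<lambda>x. Y x $ i) x - along Y (\<lambda>x. X x $ i) x = - \<kappa> x * Y x $ i"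
    and X_\<kappa>: "x \<in> W \<Longrightarrow> along X \<kappa> x = - K x - \<kappa> x ^ 2"
    and X_K: "x \<in> W \<Longrightarrow> along X K x = n x"
    and Y_K: "x \<in> W \<Longrightarrow> along Y K x = 0"
    and n_nonzero: "x \<in> W \<Longrightarrow> n x \<noteq> 0"
begin

lemmas [simp] = smooth_on_simps[OF open_W]

lemma smooth_along [simp]:
  assumes "smooth_on W f"
  shows "smooth_on W (along X f)" "smooth_on W (along Y f)"
  using assms by (simp_all add: along_def[abs_def])

lemmas pd_rules = pd_smooth[where U = W]

lemmas along_rules = along_smooth[where U = W]

lemma along_power2:
  assumes "x \<in> W" "smooth_on W f"
  shows "along V (\<lambda>x. f x ^ 2) x = 2 * f x * along V f x"
  using assms by (simp add: power2_eq_square along_rules)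

lemma commutator:
  assumes "smooth_on W f" "x \<in> W"
  shows "along X (along Y f) x - along Y (along X f) x = - \<kappa> x * along Y f x"
  unfolding along_along_commute[OF open_W assms smooth_frame] frame_bracket[OF assms(2)]
  by (simp add: along_def algebra_simps)

text \<open>Once both frame derivatives of a function are known, the commutator becomes an
  integrability condition. This is the engine of the prolongation below.\<close>

lemma compatibility:
  assumes "smooth_on W f" and "\<And>x. x \<in> W \<Longrightarrow> along X f x = u x" "\<And>x. x \<in> W \<Longrightarrow> along Y f x = v x"
    and "x \<in> W"
  shows "along X v x - along Y u x = - \<kappa> x * v x"
  using commutator[OF assms(1,4)] along_cong[where V = Y, OF open_W assms(4), of "along X f" u]
    along_cong[where V = X, OF open_W assms(4), of "along Y f" v] assms(2-4)
  by simp

text \<open>The integrability condition of \<open>K\<close>; the bracket of the frame is a multiple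
  of \<open>Y\<close>, which kills \<open>K\<close>.\<close>

lemma Y_n: "x \<in> W \<Longrightarrow> along Y n x = 0"
  using compatibility[of K n "\<lambda>x. 0" x] by (simp add: X_K Y_K along_rules)

definition n' :: "real^2 \<Rightarrow> real" where "n' = along X n"
definition \<nu> :: "real^2 \<Rightarrow> real" where "\<nu> = along Y \<kappa>"
text \<open>The logarithmic derivative of \<open>n\<close> along \<open>X\<close>.\<close>

definition \<mu> :: "real^2 \<Rightarrow> real" where "\<mu> x = n' x * inverse (n x)"
definition \<beta> :: "real^2 \<Rightarrow> real" where "\<beta> x = (\<kappa> x - \<mu> x) / 5"
text \<open>Up to the factors \<open>- 25 * n ^ 6\<close> and \<open>25 * n ^ 9\<close>, which have
  no zeros, \<open>j5\<close> and \<open>j4\<close> are the invariants \<open>J5\<close> and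
  \<open>J4\<close>; see \<open>J5_eq\<close> and \<open>J4_eq\<close>.\<close>

definition j5 :: "real^2 \<Rightarrow> real" where "j5 x = along X \<beta> x + \<beta> x ^ 2 + K x"
definition j4 :: "real^2 \<Rightarrow> real" where "j4 x = 3 * (\<beta> x - \<kappa> x) * (K x + \<kappa> x * \<beta> x) + n x"

lemma smooth_aux [simp]: "smooth_on W n'" "smooth_on W \<nu>"
  "smooth_on W \<mu>" "smooth_on W \<beta>" "smooth_on W j5" "smooth_on W j4"
proof -
  show 1: "smooth_on W n'" "smooth_on W \<nu>" by (simp_all add: n'_def \<nu>_def)
  show 2: "smooth_on W \<mu>"
    unfolding \<mu>_def[abs_def] using 1 by (simp add: smooth_on_inverse[OF open_W] n_nonzero)
  show 3: "smooth_on W \<beta>"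
    unfolding \<beta>_def[abs_def] using 2 by simp
  show "smooth_on W j5" "smooth_on W j4"
    unfolding j5_def[abs_def] j4_def[abs_def] using 3 by simp_all
qed

lemma \<mu>_n: "x \<in> W \<Longrightarrow> \<mu> x * n x = n' x"
  by (simp add: \<mu>_def n_nonzero)

lemma Y_n': "x \<in> W \<Longrightarrow> along Y n' x = 0"
  using compatibility[of n n' "\<lambda>x. 0" x] by (simp add: n'_def Y_n along_rules)

lemma along_\<mu>:
  assumes "x \<in> W"
  shows "along V \<mu> x * n x + \<mu> x * along V n x = along V n' x"
  using along_cong[OF open_W assms, of "\<lambda>x. \<mu> x * n x" n' V] assms
  by (simp add: \<mu>_n along_rules)

lemma Y_\<mu>: "x \<in> W \<Longrightarrow> along Y \<mu> x = 0"
  using along_\<mu>[of x Y] by (simp add: Y_n Y_n' n_nonzero)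

lemma along_\<beta>: "x \<in> W \<Longrightarrow> along V \<beta> x = (along V \<kappa> x - along V \<mu> x) / 5"
  unfolding \<beta>_def[abs_def] by (simp add: along_rules)

lemma Y_\<beta>: "x \<in> W \<Longrightarrow> along Y \<beta> x = \<nu> x / 5"
  by (simp add: along_\<beta> Y_\<mu> \<nu>_def)

text \<open>Integrability condition of \<open>\<kappa>\<close>, whose derivative along
  \<open>X\<close> is given by the Riccati equation \<open>X_\<kappa>\<close>; \<open>Y_K\<close>
  removes the curvature term.\<close>

lemma X_\<nu>: "x \<in> W \<Longrightarrow> along X \<nu> x = - 3 * \<kappa> x * \<nu> x"
  using compatibility[of \<kappa> "\<lambda>x. - K x - \<kappa> x ^ 2" \<nu> x]
  by (simp add: X_\<kappa> \<nu>_def[symmetric] along_rules along_power2 Y_K)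

text \<open>Comes from the integrability condition of \<open>\<beta>\<close>. On an open set where
  \<open>j5\<close> vanishes it leaves only \<open>\<nu> = 0\<close> or
  \<open>\<beta> = \<kappa>\<close>, which \<open>B_zero\<close> exploits.\<close>

lemma Y_j5:
  assumes "x \<in> W"
  shows "along Y j5 x = (2/5) * \<nu> x * (\<beta> x - \<kappa> x)"
proof -
  have "along X (\<lambda>x. \<nu> x / 5) x - along Y (along X \<beta>) x = - \<kappa> x * (\<nu> x / 5)"
    using compatibility[of \<beta> "along X \<beta>" "\<lambda>x. \<nu> x / 5" x] assms by (simp add: Y_\<beta>)
  then have "along Y (along X \<beta>) x = - (2/5) * \<kappa> x * \<nu> x"
    using assms by (simp add: along_rules X_\<nu> algebra_simps)
  then show ?thesis
    unfolding j5_def[abs_def] using assms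
    by (simp add: along_rules along_power2 Y_\<beta> Y_K algebra_simps)
qed

end

subsection \<open>Compatibility conditions of the Killing equations\<close>

text \<open>The four equations set to zero the coefficients of the cubic form in the momenta
  computed in \<open>poisson_bracket_quad\<close>.\<close>

locale killing_tensor = adapted_frame +
  fixes A B C :: "real^2 \<Rightarrow> real"
  assumes smooth_ABC [simp]: "smooth_on W A" "smooth_on W B" "smooth_on W C"
    and X_A: "x \<in> W \<Longrightarrow> along X A x = 0"
    and Y_A: "x \<in> W \<Longrightarrow> along Y A x = 2 * \<kappa> x * B x - 2 * along X B x"
    and X_C: "x \<in> W \<Longrightarrow> along X C x = 2 * \<kappa> x * (C x - A x) - 2 * along Y B x"
    and Y_C: "x \<in> W \<Longrightarrow> along Y C x = - 2 * \<kappa> x * B x"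
begin

text \<open>Multiples of the Hamiltonian have \<open>A = C\<close> and \<open>B = 0\<close>, so
  passing from \<open>C\<close> to \<open>D\<close> splits them off.\<close>

definition D :: "real^2 \<Rightarrow> real" where "D x = C x - A x"
definition P :: "real^2 \<Rightarrow> real" where "P = along X B"
definition Q :: "real^2 \<Rightarrow> real" where "Q = along Y B"
definition R :: "real^2 \<Rightarrow> real" where "R = along Y P"

lemma smooth_DPQR [simp]: "smooth_on W D" "smooth_on W P" "smooth_on W Q" "smooth_on W R"
  by (simp_all add: D_def[abs_def] P_def Q_def R_def)

lemma X_D: "x \<in> W \<Longrightarrow> along X D x = 2 * \<kappa> x * D x - 2 * Q x"
  by (simp add: D_def[abs_def] along_rules X_A X_C Q_def)

lemma Y_D: "x \<in> W \<Longrightarrow> along Y D x = - 4 * \<kappa> x * B x + 2 * P x"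
  by (simp add: D_def[abs_def] along_rules Y_A Y_C P_def)

lemmas first_order = P_def[symmetric] Q_def[symmetric] \<nu>_def[symmetric]
  X_D Y_D X_\<kappa> X_\<nu> X_K Y_K Y_n n'_def[symmetric]

text \<open>From here to \<open>Y_R\<close>, the integrability conditions of \<open>A\<close>,
  \<open>C\<close>, \<open>B\<close>, \<open>P\<close> and \<open>Q\<close> in turn supply the
  missing derivatives of \<open>P\<close>, \<open>Q\<close> and \<open>R\<close>, which closes the
  system.\<close>

lemma X_P: "x \<in> W \<Longrightarrow> along X P x = - K x * B x"
  using compatibility[of A "\<lambda>x. 0" "\<lambda>x. 2 * \<kappa> x * B x - 2 * P x" x]
  by (simp add: X_A Y_A along_rules first_order) algebra

lemma Y_Q: "x \<in> W \<Longrightarrow> along Y Q x = (- K x - 4 * \<kappa> x ^ 2) * B x + 3 * \<kappa> x * P x + \<nu> x * D x"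
  using compatibility[of C "\<lambda>x. 2 * \<kappa> x * D x - 2 * Q x" "\<lambda>x. - 2 * \<kappa> x * B x" x]
  by (simp add: X_C Y_C D_def[symmetric] along_rules first_order) algebra

lemma X_Q: "x \<in> W \<Longrightarrow> along X Q x = R x - \<kappa> x * Q x"
  using compatibility[of B P Q x] by (simp add: P_def Q_def R_def)

lemma X_R: "x \<in> W \<Longrightarrow> along X R x = - \<kappa> x * R x - K x * Q x"
  using compatibility[of P "\<lambda>x. - K x * B x" R x]
  by (simp add: X_P R_def[symmetric] along_rules first_order)

lemma Y_R: "x \<in> W \<Longrightarrow> along Y R x = (- n x + 3 * \<kappa> x * K x) * B x
    + (- 4 * K x - \<kappa> x ^ 2) * P x + \<kappa> x * \<nu> x * D x - \<nu> x * Q x"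
  using compatibility[of Q "\<lambda>x. R x - \<kappa> x * Q x"
      "\<lambda>x. (- K x - 4 * \<kappa> x ^ 2) * B x + 3 * \<kappa> x * P x + \<nu> x * D x" x]
  by (simp add: X_Q Y_Q along_rules along_power2 first_order X_P) algebra

text \<open>Integrability condition of \<open>R\<close>, the last unknown: \<open>D\<close>,
  \<open>Q\<close> and \<open>R\<close> drop out and
  \<open>5 * n * P = (\<kappa> * n - n') * B\<close> remains, whence the 5 in
  \<open>\<beta>\<close>.\<close>

lemma P_eq_\<beta>_B:
  assumes x: "x \<in> W"
  shows "P x = \<beta> x * B x"
proof -
  have "5 * n x * P x = (\<kappa> x * n x - n' x) * B x"
    using compatibility[of R "\<lambda>x. - \<kappa> x * R x - K x * Q x" "\<lambda>x. (- n x + 3 * \<kappa> x * K x) * B x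
      + (- 4 * K x - \<kappa> x ^ 2) * P x + \<kappa> x * \<nu> x * D x - \<nu> x * Q x" x] x
    by (simp add: X_R Y_R along_rules along_power2 first_order X_P X_Q Y_Q R_def[symmetric]) algebra
  then have "5 * n x * P x = n x * (5 * \<beta> x * B x)"
    using \<mu>_n[OF x, symmetric] by (simp add: \<beta>_def algebra_simps)
  then show ?thesis using n_nonzero[OF x] by simp
qed

text \<open>Compares \<open>X_P\<close> with the derivative along \<open>X\<close> of the relation
  \<open>P_eq_\<beta>_B\<close>.\<close>

lemma j5_B:
  assumes x: "x \<in> W"
  shows "j5 x * B x = 0"
proof -
  have "along X P x = along X (\<lambda>y. \<beta> y * B y) x"
    by (rule along_cong[OF open_W x P_eq_\<beta>_B])
  also have "\<dots> = along X \<beta> x * B x + \<beta> x * P x"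
    using x by (simp add: along_rules P_def)
  finally show ?thesis
    unfolding X_P[OF x] P_eq_\<beta>_B[OF x] j5_def by algebra
qed

text \<open>A first derivative of \<open>P_eq_\<beta>_B\<close> along \<open>Y\<close> expresses
  \<open>R\<close> by \<open>B\<close> and \<open>Q\<close>; a second one is compared with
  \<open>Y_R\<close>.\<close>

lemma j4_B:
  assumes x: "x \<in> W"
  shows "(7/5) * \<nu> x * Q x + (\<beta> x - \<kappa> x) * \<nu> x * D x + (along Y \<nu> x / 5 + j4 x) * B x = 0"
proof -
  have R: "R y = \<nu> y * B y / 5 + \<beta> y * Q y" if "y \<in> W" for y
    using along_cong[OF open_W that P_eq_\<beta>_B, where V = Y] that
    by (simp add: along_rules Y_\<beta> first_order R_def)
  have "along Y R x = along Y (\<lambda>y. \<nu> y * B y / 5 + \<beta> y * Q y) x"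
    by (rule along_cong[OF open_W x R])
  also have "\<dots> = along Y \<nu> x * B x / 5 + (2/5) * \<nu> x * Q x
      + \<beta> x * ((- K x - 4 * \<kappa> x ^ 2) * B x + 3 * \<kappa> x * P x + \<nu> x * D x)"
    using x by (simp add: along_rules first_order Y_\<beta> Y_Q algebra_simps add_divide_distrib)
  finally show ?thesis
    unfolding Y_R[OF x] P_eq_\<beta>_B[OF x] j4_def by (simp add: algebra_simps power2_eq_square)
qed

text \<open>If \<open>j5\<close> has no zeros, \<open>j5_B\<close> suffices. Otherwise, on the open
  set \<open>V\<close> where \<open>B\<close> is nonzero, \<open>j5\<close> and with it its
  derivative along \<open>Y\<close> vanish. This makes \<open>\<nu>\<close> vanish on
  \<open>V\<close>, and \<open>j4_B\<close> reduces to \<open>j4 * B = 0\<close>.\<close>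

lemma B_zero:
  assumes nondeg: "(\<forall>x\<in>W. j5 x \<noteq> 0) \<or> (\<forall>x\<in>W. j4 x \<noteq> 0)" and x: "x \<in> W"
  shows "B x = 0"
proof (rule ccontr)
  assume B: "B x \<noteq> 0"
  with j5_B[OF x] nondeg x have q: "\<forall>x\<in>W. j4 x \<noteq> 0" by auto
  have pos_open: "open {y \<in> V. u y \<noteq> 0}" if "open V" "smooth_on V u" for V u
  proof -
    have "open (V \<inter> u -` (- {0}))"
      by (intro continuous_open_preimage continuous_on_smooth that) auto
    moreover have "V \<inter> u -` (- {0}) = {y \<in> V. u y \<noteq> 0}" by auto
    ultimately show ?thesis by simp
  qed
  define V where "V = {y \<in> W. B y \<noteq> 0}"
  have V: "open V" "x \<in> V" "V \<subseteq> W"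
    using pos_open[OF open_W smooth_ABC(2)] x B by (auto simp: V_def)
  have jV: "j5 y = 0" if "y \<in> V" for y
    using j5_B[of y] that by (auto simp: V_def)
  have "along Y j5 y = 0" if "y \<in> V" for y
    using along_cong[OF V(1) that jV, where V = Y] by (simp add: along_def)
  then have V0: "\<nu> y = 0 \<or> \<beta> y = \<kappa> y" if "y \<in> V" for y
    using Y_j5[of y] that V(3) by auto
  define V' where "V' = {y \<in> V. \<nu> y \<noteq> 0}"
  have V': "open V'" "V' \<subseteq> V"
    using pos_open[OF V(1) smooth_on_subset[OF smooth_aux(2) V(3)]] by (auto simp: V'_def)
  have \<nu>0: "\<nu> y = 0" if "y \<in> V" for y
  proof (rule ccontr)
    assume "\<nu> y \<noteq> 0"
    then have y: "y \<in> V'" using that by (simp add: V'_def)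
    \<comment> \<open>On the open set \<open>V'\<close> the alternative left by \<open>V0\<close> is
      \<open>\<beta> = \<kappa>\<close>; its derivative along \<open>Y\<close> reads
      \<open>\<nu> / 5 = \<nu>\<close>.\<close>
    have "along Y \<beta> y = along Y \<kappa> y"
      by (rule along_cong[OF V'(1) y]) (use V0 in \<open>auto simp: V'_def\<close>)
    then show False
      using Y_\<beta>[of y] \<open>\<nu> y \<noteq> 0\<close> that V(3) by (auto simp: \<nu>_def)
  qed
  have "along Y \<nu> x = 0"
    using along_cong[OF V(1,2) \<nu>0, where V = Y] by (simp add: along_def)
  then have "j4 x * B x = 0"
    using j4_B[OF x] \<nu>0[OF V(2)] by simp
  with B q x show False by simp
qed

text \<open>With \<open>B\<close> also its derivatives \<open>P\<close> and \<open>Q\<close> vanish,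
  and of \<open>Y_Q\<close> only the term \<open>\<nu> * D\<close> survives.\<close>

lemma nondegenerate_solution:
  assumes nondeg: "(\<forall>x\<in>W. j5 x \<noteq> 0) \<or> (\<forall>x\<in>W. j4 x \<noteq> 0)" and x: "x \<in> W"
  shows "B x = 0" "along Y A x = 0" "along X D x = 2 * \<kappa> x * D x" "along Y D x = 0"
    and "\<nu> x * D x = 0"
proof -
  have 0: "B y = 0" if "y \<in> W" for y by (rule B_zero[OF nondeg that])
  have PQ: "P y = 0" "Q y = 0" if "y \<in> W" for y
    using along_cong[OF open_W that 0] by (simp_all add: P_def Q_def along_def)
  have "along Y Q x = 0"
    using along_cong[OF open_W x PQ(2), where V = Y] by (simp add: along_def)
  with 0 PQ x show "B x = 0" "along Y A x = 0" "along X D x = 2 * \<kappa> x * D x" "along Y D x = 0"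
    "\<nu> x * D x = 0"
    using Y_Q[OF x] Y_A[OF x] X_D[OF x] Y_D[OF x] by (auto simp: P_def[symmetric])
qed

end

subsection \<open>Quadratic integrals in an adapted frame\<close>

text \<open>The brackets are the values of the covector \<open>p\<close> on \<open>X\<close> and
  \<open>Y\<close>. For \<open>A = C = 1\<close> and \<open>B = 0\<close> this is the Hamiltonian of
  the metric in which the frame is orthonormal.\<close>

definition quad ::
    "(real^2 \<Rightarrow> real^2) \<Rightarrow> (real^2 \<Rightarrow> real^2) \<Rightarrow> (real^2 \<Rightarrow> real) \<Rightarrow> (real^2 \<Rightarrow> real) \<Rightarrow>
      (real^2 \<Rightarrow> real) \<Rightarrow> real^2 \<Rightarrow> real^2 \<Rightarrow> real" where
  "quad X Y A B C x p = A x * (X x $ 1 * p $ 1 + X x $ 2 * p $ 2)\<^sup>2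
     + 2 * B x * (X x $ 1 * p $ 1 + X x $ 2 * p $ 2) * (Y x $ 1 * p $ 1 + Y x $ 2 * p $ 2)
     + C x * (Y x $ 1 * p $ 1 + Y x $ 2 * p $ 2)\<^sup>2"

lemma poisson_bracket_cong:
  assumes "open W" "x \<in> W" "\<And>y p. y \<in> W \<Longrightarrow> F y p = F' y p" "\<And>y p. y \<in> W \<Longrightarrow> G y p = G' y p"
  shows "poisson_bracket F G x p = poisson_bracket F' G' x p"
proof -
  have "F x = F' x" "G x = G' x" using assms by auto
  moreover have "pd i (\<lambda>y. F y p) x = pd i (\<lambda>y. F' y p) x" "pd i (\<lambda>y. G y p) x = pd i (\<lambda>y. G' y p) x" for i
    using assms by (auto intro: pd_cong[OF assms(1,2)])
  ultimately show ?thesis by (simp add: poisson_bracket_def)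
qed

lemma quad_pairs: "{(i, j). i + j = (2::nat)} = {(0, 2), (1, 1), (2, 0)}"
  by auto

lemma pd_quadratic_form:
  "pd i (\<lambda>p. a * (u * p $ 1 + v * p $ 2)\<^sup>2 + 2 * b * (u * p $ 1 + v * p $ 2) * (z * p $ 1 + w * p $ 2)
      + c * (z * p $ 1 + w * p $ 2)\<^sup>2) p
    = (2 * a * (u * p $ 1 + v * p $ 2) + 2 * b * (z * p $ 1 + w * p $ 2)) * (if i = 1 then u else v)
    + (2 * b * (u * p $ 1 + v * p $ 2) + 2 * c * (z * p $ 1 + w * p $ 2)) * (if i = 1 then z else w)"
proof (rule pd_eqI[THEN trans])
  show "((\<lambda>p. a * (u * p $ 1 + v * p $ 2)\<^sup>2 + 2 * b * (u * p $ 1 + v * p $ 2) * (z * p $ 1 + w * p $ 2)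
      + c * (z * p $ 1 + w * p $ 2)\<^sup>2) has_derivative
      (\<lambda>q. (2 * a * (u * p $ 1 + v * p $ 2) + 2 * b * (z * p $ 1 + w * p $ 2)) * (u * q $ 1 + v * q $ 2)
      + (2 * b * (u * p $ 1 + v * p $ 2) + 2 * c * (z * p $ 1 + w * p $ 2)) * (z * q $ 1 + w * q $ 2))) (at p)"
    by (auto intro!: derivative_eq_intros bounded_linear.has_derivative[OF bounded_linear_vec_nth]
        simp: fun_eq_iff algebra_simps)
qed (use exhaust_2[of i] in \<open>auto simp: axis_def\<close>)

lemma adapted_frame_subset:
  assumes "adapted_frame W X Y \<kappa> K n" "open V" "V \<subseteq> W"
  shows "adapted_frame V X Y \<kappa> K n"
  using assms unfolding adapted_frame_def by (meson smooth_on_subset subsetD)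

context adapted_frame
begin

text \<open>Both functions are quadratic forms in the frame momenta \<open>p1\<close>,
  \<open>p2\<close>. The derivatives of the frame enter only through the bracket of these momenta,
  which \<open>frame_bracket\<close> gives.\<close>

lemma poisson_bracket_quad:
  assumes [simp]: "smooth_on W A" "smooth_on W B" "smooth_on W C" and x: "x \<in> W"
    and p: "p1 = X x $ 1 * p $ 1 + X x $ 2 * p $ 2" "p2 = Y x $ 1 * p $ 1 + Y x $ 2 * p $ 2"
  shows "poisson_bracket (quad X Y (\<lambda>x. 1) (\<lambda>x. 0) (\<lambda>x. 1)) (quad X Y A B C) x p =
    - 2 * (along X A x * p1 ^ 3 + (along Y A x - 2 * \<kappa> x * B x + 2 * along X B x) * p1\<^sup>2 * p2
      + (along X C x - 2 * \<kappa> x * (C x - A x) + 2 * along Y B x) * p1 * p2\<^sup>2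
      + (along Y C x + 2 * \<kappa> x * B x) * p2 ^ 3)"
proof -
  \<comment> \<open>\<open>a i\<close> and \<open>b i\<close> are the derivatives of
    \<open>p1\<close> and \<open>p2\<close> in the base direction \<open>i\<close>, with
    \<open>p\<close> fixed.\<close>
  define a where "a i = pd i (\<lambda>y. X y $ 1) x * p $ 1 + pd i (\<lambda>y. X y $ 2) x * p $ 2" for i
  define b where "b i = pd i (\<lambda>y. Y y $ 1) x * p $ 1 + pd i (\<lambda>y. Y y $ 2) x * p $ 2" for i
  have dx: "pd i (\<lambda>y. quad X Y A B C y p) x = pd i A x * p1\<^sup>2 + 2 * pd i B x * p1 * p2 + pd i C x * p2\<^sup>2
      + (2 * A x * p1 + 2 * B x * p2) * a i + (2 * B x * p1 + 2 * C x * p2) * b i"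
    if [simp]: "smooth_on W A" "smooth_on W B" "smooth_on W C" for A B C i
    unfolding quad_def power2_eq_square using x
    by (simp add: pd_rules p a_def b_def algebra_simps)
  have dp: "pd i (quad X Y A B C x) p = (2 * A x * p1 + 2 * B x * p2) * X x $ i
      + (2 * B x * p1 + 2 * C x * p2) * Y x $ i" for A B C i
    using pd_quadratic_form exhaust_2[of i] unfolding quad_def[abs_def] p by fastforce
  \<comment> \<open>The value of \<open>p\<close> on the Lie bracket of \<open>X\<close> and
    \<open>Y\<close>, which is the Poisson bracket of \<open>p1\<close> and \<open>p2\<close> up to
    sign.\<close>
  have br: "X x $ 1 * b 1 + X x $ 2 * b 2 - (Y x $ 1 * a 1 + Y x $ 2 * a 2) = - \<kappa> x * p2"
    using frame_bracket[OF x, of 1] frame_bracket[OF x, of 2]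
    unfolding along_def a_def b_def p by algebra
  show ?thesis
    unfolding poisson_bracket_def sum_2 along_def
    unfolding dp dx[OF assms(1-3)] dx[OF smooth_on_const smooth_on_const smooth_on_const, OF open_W open_W open_W]
    using br by (simp add: pd_const) algebra
qed

lemma frame_momenta:
  assumes x: "x \<in> W"
  shows "\<exists>p::real^2. X x $ 1 * p $ 1 + X x $ 2 * p $ 2 = p1 \<and> Y x $ 1 * p $ 1 + Y x $ 2 * p $ 2 = p2"
proof -
  define d where "d = X x $ 1 * Y x $ 2 - X x $ 2 * Y x $ 1"
  have d: "d \<noteq> 0" using frame_det[OF x] by (simp add: d_def)
  define p :: "real^2" where
    "p = vector [(Y x $ 2 * p1 - X x $ 2 * p2) / d, (X x $ 1 * p2 - Y x $ 1 * p1) / d]"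
  have "d * (X x $ 1 * p $ 1 + X x $ 2 * p $ 2) = d * p1"
    "d * (Y x $ 1 * p $ 1 + Y x $ 2 * p $ 2) = d * p2"
    using d unfolding p_def by (simp_all add: field_simps) (simp_all add: d_def algebra_simps)
  then show ?thesis
    using d by auto
qed

lemma killing_tensorI:
  assumes "smooth_on W A" "smooth_on W B" "smooth_on W C"
    and "\<And>x p. x \<in> W \<Longrightarrow> poisson_bracket (quad X Y (\<lambda>x. 1) (\<lambda>x. 0) (\<lambda>x. 1)) (quad X Y A B C) x p = 0"
  shows "killing_tensor W X Y \<kappa> K n A B C"
proof -
  have eqs: "along X A x = 0 \<and> along Y A x - 2 * \<kappa> x * B x + 2 * along X B x = 0
     \<and> along X C x - 2 * \<kappa> x * (C x - A x) + 2 * along Y B x = 0 \<and> along Y C x + 2 * \<kappa> x * B x = 0"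
    if x: "x \<in> W" for x
  proof -
    have *: "along X A x * p1 ^ 3 + (along Y A x - 2 * \<kappa> x * B x + 2 * along X B x) * p1\<^sup>2 * p2
      + (along X C x - 2 * \<kappa> x * (C x - A x) + 2 * along Y B x) * p1 * p2\<^sup>2
      + (along Y C x + 2 * \<kappa> x * B x) * p2 ^ 3 = 0" for p1 p2
    proof -
      obtain p :: "real^2" where "p1 = X x $ 1 * p $ 1 + X x $ 2 * p $ 2" "p2 = Y x $ 1 * p $ 1 + Y x $ 2 * p $ 2"
        using frame_momenta[OF x] by metis
      from poisson_bracket_quad[OF assms(1-3) x this] assms(4)[OF x] show ?thesis
        by simp
    qed
    \<comment> \<open>A binary cubic form that vanishes at these four momenta is zero: the first two
      give the outer coefficients, the last two the sum and difference of the inner ones.\<close>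
    show ?thesis
      using *[of 1 0] *[of 0 1] *[of 1 1] *[of 1 "-1"] by simp
  qed
  show ?thesis
    by (unfold_locales) (use assms eqs in \<open>fastforce simp: algebra_simps\<close>)+
qed

lemma quad_of_coefficients:
  assumes [simp]: "\<And>i j. i + j = 2 \<Longrightarrow> smooth_on W (u i j)"
    and F: "\<And>x p. x \<in> W \<Longrightarrow> F x p = (\<Sum>(i, j) | i + j = (2::nat). u i j x * p $ 1 ^ i * p $ 2 ^ j)"
  obtains A B C where "smooth_on W A" "smooth_on W B" "smooth_on W C"
    "\<And>x p. x \<in> W \<Longrightarrow> F x p = quad X Y A B C x p"
proof -
  define d where "d x = (X x $ 1 * Y x $ 2 - X x $ 2 * Y x $ 1)\<^sup>2" for x
  have d: "d x \<noteq> 0" if "x \<in> W" for x using frame_det[OF that] by (simp add: d_def)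
  have [simp]: "smooth_on W d" by (simp add: d_def[abs_def])
  \<comment> \<open>Found by solving the frame momenta for \<open>p\<close> with Cramer's rule and
    substituting; \<open>d\<close> is the square of the frame determinant because the form is
    quadratic.\<close>
  define A where "A x = (u 2 0 x * Y x $ 2 * Y x $ 2 - u 1 1 x * Y x $ 1 * Y x $ 2
      + u 0 2 x * Y x $ 1 * Y x $ 1) / d x" for x
  define B where "B x = (- 2 * u 2 0 x * X x $ 2 * Y x $ 2
      + u 1 1 x * (X x $ 1 * Y x $ 2 + X x $ 2 * Y x $ 1) - 2 * u 0 2 x * X x $ 1 * Y x $ 1) / (2 * d x)" for x
  define C where "C x = (u 2 0 x * X x $ 2 * X x $ 2 - u 1 1 x * X x $ 1 * X x $ 2
      + u 0 2 x * X x $ 1 * X x $ 1) / d x" for x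
  show ?thesis
  proof (rule that[of A B C])
    show "smooth_on W A" "smooth_on W B" "smooth_on W C"
      unfolding A_def[abs_def] B_def[abs_def] C_def[abs_def]
      by (auto intro!: smooth_on_divide[OF open_W] simp: d)
    fix x p assume x: "x \<in> W"
    have "d x * quad X Y A B C x p = (d x * A x) * (X x $ 1 * p $ 1 + X x $ 2 * p $ 2)\<^sup>2
     + (2 * d x * B x) * (X x $ 1 * p $ 1 + X x $ 2 * p $ 2) * (Y x $ 1 * p $ 1 + Y x $ 2 * p $ 2)
     + (d x * C x) * (Y x $ 1 * p $ 1 + Y x $ 2 * p $ 2)\<^sup>2"
      unfolding quad_def by algebra
    also have "\<dots> = d x * (u 2 0 x * p $ 1 ^ 2 + u 1 1 x * p $ 1 * p $ 2 + u 0 2 x * p $ 2 ^ 2)"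
      using d[OF x] unfolding A_def B_def C_def
      by simp (unfold d_def, algebra)
    finally show "F x p = quad X Y A B C x p"
      using d[OF x] unfolding F[OF x] quad_pairs by simp
  qed
qed

lemma homogeneous_quad:
  assumes [simp]: "smooth_on W A" "smooth_on W B" "smooth_on W C"
  shows "\<exists>u. (\<forall>i j. i + j = 2 \<longrightarrow> smooth_on W (u i j)) \<and>
    (\<forall>x\<in>W. \<forall>p. quad X Y A B C x p = (\<Sum>(i, j) | i + j = (2::nat). u i j x * p $ 1 ^ i * p $ 2 ^ j))"
proof -
  define u where "u i j x = (if i = (2::nat) then A x * (X x $ 1)\<^sup>2 + 2 * B x * X x $ 1 * Y x $ 1 + C x * (Y x $ 1)\<^sup>2
    else if i = 1 then 2 * A x * X x $ 1 * X x $ 2 + 2 * B x * (X x $ 1 * Y x $ 2 + X x $ 2 * Y x $ 1)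
      + 2 * C x * Y x $ 1 * Y x $ 2
    else A x * (X x $ 2)\<^sup>2 + 2 * B x * X x $ 2 * Y x $ 2 + C x * (Y x $ 2)\<^sup>2)" for i and j :: nat and x
  have "smooth_on W (u i j)" for i j
    by (cases "i = 2"; cases "i = 1") (simp_all add: u_def[abs_def])
  moreover have "quad X Y A B C x p = (\<Sum>(i, j) | i + j = (2::nat). u i j x * p $ 1 ^ i * p $ 2 ^ j)" for x p
    unfolding quad_pairs quad_def by (simp add: u_def) algebra
  ultimately show ?thesis by blast
qed

text \<open>Cramer's rule again; a known factor times \<open>f\<close> is the form that
  \<open>log_gradient_zero\<close> takes.\<close>

lemma pd_from_along:
  assumes "x \<in> W" "along X f x = u * f x" "along Y f x = 0"
  shows "pd 1 f x = (u * Y x $ 2 / (X x $ 1 * Y x $ 2 - X x $ 2 * Y x $ 1)) * f x"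
    "pd 2 f x = (- u * Y x $ 1 / (X x $ 1 * Y x $ 2 - X x $ 2 * Y x $ 1)) * f x"
proof -
  define d where "d = X x $ 1 * Y x $ 2 - X x $ 2 * Y x $ 1"
  have d: "d \<noteq> 0" using frame_det[OF assms(1)] by (simp add: d_def)
  have "d * pd 1 f x = u * Y x $ 2 * f x" "d * pd 2 f x = - u * Y x $ 1 * f x"
    using assms(2,3) unfolding along_def d_def by algebra+
  then show "pd 1 f x = (u * Y x $ 2 / (X x $ 1 * Y x $ 2 - X x $ 2 * Y x $ 1)) * f x"
    "pd 2 f x = (- u * Y x $ 1 / (X x $ 1 * Y x $ 2 - X x $ 2 * Y x $ 1)) * f x"
    using d unfolding d_def[symmetric] by (simp_all add: field_simps)
qed

lemma along_zero_imp_constant: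
  assumes "convex W" "smooth_on W f" "\<And>x. x \<in> W \<Longrightarrow> along X f x = 0" "\<And>x. x \<in> W \<Longrightarrow> along Y f x = 0"
    and "x \<in> W" "y \<in> W"
  shows "f x = f y"
proof (rule pd_zero_imp_constant[OF assms(1) open_W _ _ assms(5,6)])
  fix i z assume z: "z \<in> W"
  show "pd i f z = 0"
    using pd_from_along[OF z, of f 0] assms(3,4)[OF z] exhaust_2[of i] by auto
qed (use assms smooth_on_differentiable in blast)

text \<open>Here \<open>exp (2 h) p\<^sub>Y\<^sup>2\<close> is the square of the momentum of a Killing field:
  \<open>\<nu> = 0\<close> says exactly that the 1-form dual to \<open>\<kappa> X\<close> is closed.\<close>

lemma integrating_factor:
  assumes W: "W = ball c r" and \<nu>: "\<And>x. x \<in> W \<Longrightarrow> \<nu> x = 0"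
  obtains h where "smooth_on W h" "\<And>x. x \<in> W \<Longrightarrow> along X h x = \<kappa> x" "\<And>x. x \<in> W \<Longrightarrow> along Y h x = 0"
proof -
  define d where "d x = X x $ 1 * Y x $ 2 - X x $ 2 * Y x $ 1" for x
  have d: "d x \<noteq> 0" if "x \<in> W" for x using frame_det[OF that] by (simp add: d_def)
  have [simp]: "smooth_on W d" by (simp add: d_def[abs_def])
  \<comment> \<open>The components of the 1-form with value \<open>\<kappa>\<close> on
    \<open>X\<close> and 0 on \<open>Y\<close>.\<close>
  define a where "a x = \<kappa> x * Y x $ 2 / d x" for x
  define b where "b x = - (\<kappa> x * Y x $ 1) / d x" for x
  have ab [simp]: "smooth_on W a" "smooth_on W b"
    unfolding a_def[abs_def] b_def[abs_def] by (rule smooth_on_divide[OF open_W]; simp add: d)+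
  have abX: "a x * X x $ 1 + b x * X x $ 2 = \<kappa> x" and abY: "a x * Y x $ 1 + b x * Y x $ 2 = 0"
    if "x \<in> W" for x
    using d[OF that] unfolding a_def b_def by (simp_all add: field_simps) (simp add: d_def algebra_simps)
  have "pd 1 b x = pd 2 a x" if x: "x \<in> W" for x
  proof -
    \<comment> \<open>For this 1-form \<open>\<theta>\<close>, closedness follows from
      \<open>d\<theta>(X,Y) = X(\<theta>(Y)) - Y(\<theta>(X)) - \<theta>([X,Y])\<close>: the first
      two terms vanish since \<open>\<theta>(Y) = 0\<close> and \<open>\<nu> = 0\<close>, the third
      since the bracket is a multiple of \<open>Y\<close>.\<close>
    have "along X (\<lambda>x. a x * Y x $ 1 + b x * Y x $ 2) x = 0"
      using along_cong[OF open_W x abY] by (simp add: along_def)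
    moreover have "along Y (\<lambda>x. a x * X x $ 1 + b x * X x $ 2) x = 0"
      using along_cong[OF open_W x abX, where V = Y] \<nu>[OF x] by (simp add: \<nu>_def)
    ultimately have "d x * (pd 1 b x - pd 2 a x) - \<kappa> x * (a x * Y x $ 1 + b x * Y x $ 2) = 0"
      using frame_bracket[OF x, of 1] frame_bracket[OF x, of 2] x
      by (simp add: along_rules) (simp add: along_def d_def, algebra)
    then show ?thesis using d[OF x] abY[OF x] by simp
  qed
  with ab obtain h where h: "smooth_on W h" "\<And>x. x \<in> W \<Longrightarrow> pd 1 h x = a x" "\<And>x. x \<in> W \<Longrightarrow> pd 2 h x = b x"
    unfolding W by (metis poincare_lemma_ball)
  show ?thesis
    by (rule that[OF h(1)]) (use h abX abY in \<open>auto simp: along_def mult.commute\<close>)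
qed

lemma along_exp:
  assumes "x \<in> W" "smooth_on W h"
  shows "along V (\<lambda>x. exp (h x)) x = exp (h x) * along V h x"
  using pd_comp(2)[OF smooth_on_differentiable[OF assms(2,1)] DERIV_exp]
  by (simp add: along_def algebra_simps)

end

section \<open>Germs of quadratic integrals and their dimension\<close>

lemma homogeneous_integral_on_subset:
  "homogeneous_integral_on g U m F \<Longrightarrow> V \<subseteq> U \<Longrightarrow> homogeneous_integral_on g V m F"
  unfolding homogeneous_integral_on_def by (meson smooth_on_subset subsetD)

lemma germ_at_scaleR: "germ_at x0 (\<lambda>x p. r * F x p) = r *\<^sub>R germ_at x0 F"
  by (simp add: germ_at_def scaleR_cotangent_germ.abs_eq)

lemma germ_at_add: "germ_at x0 (\<lambda>x p. F x p + G x p) = germ_at x0 F + germ_at x0 G"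
  by (simp add: germ_at_def plus_cotangent_germ.abs_eq)

lemma germ_at_eqI:
  "open V \<Longrightarrow> x0 \<in> V \<Longrightarrow> (\<And>x p. x \<in> V \<Longrightarrow> F x p = G x p) \<Longrightarrow> germ_at x0 F = germ_at x0 G"
  unfolding germ_at_eq_iff by (auto simp: eventually_nhds)

lemma germ_at_eqD: "germ_at x0 F = germ_at x0 G \<Longrightarrow> F x0 p = G x0 p"
  unfolding germ_at_eq_iff by (auto dest: eventually_nhds_x_imp_x)

lemma span_pair: "span {a, b} = {r *\<^sub>R a + s *\<^sub>R b |r s. True}"
  for a b :: "'v::real_vector"
  by (auto simp: real_vector.span_insert span_singleton algebra_simps)

lemma smooth_nonzero_nhd:
  assumes "open U" "smooth_on U u" "x0 \<in> U" "u x0 \<noteq> 0"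
  shows "\<forall>\<^sub>F x in nhds x0. x \<in> U \<and> u x \<noteq> 0"
proof -
  have "open (U \<inter> u -` (- {0}))"
    by (intro continuous_open_preimage continuous_on_smooth assms) auto
  from eventually_nhds_in_open[OF this, of x0] show ?thesis
    using assms(3,4) by simp
qed

lemma eventually_ball:
  assumes "eventually Q (nhds (x0::real^2))"
  obtains s where "s > 0" "\<And>x. x \<in> ball x0 s \<Longrightarrow> Q x"
  using assms unfolding eventually_nhds_metric by (metis dist_commute mem_ball)

context adapted_frame
begin

lemma quad_integral:
  assumes ham: "\<And>x p. x \<in> W \<Longrightarrow> hamiltonian g x p = quad X Y (\<lambda>x. 1) (\<lambda>x. 0) (\<lambda>x. 1) x p"
    and "smooth_on W A" "smooth_on W B" "smooth_on W C"
    and "\<And>x p. x \<in> W \<Longrightarrow> poisson_bracket (quad X Y (\<lambda>x. 1) (\<lambda>x. 0) (\<lambda>x. 1)) (quad X Y A B C) x p = 0"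
  shows "homogeneous_integral_on g W 2 (quad X Y A B C)"
  unfolding homogeneous_integral_on_def
  using homogeneous_quad[OF assms(2-4)] assms(5) poisson_bracket_cong[OF open_W _ ham, of _ _ "quad X Y A B C"]
  by simp

lemma integral_killing_tensor:
  assumes ham: "\<And>x p. x \<in> W \<Longrightarrow> hamiltonian g x p = quad X Y (\<lambda>x. 1) (\<lambda>x. 0) (\<lambda>x. 1) x p"
    and F: "homogeneous_integral_on g W 2 F"
  obtains A B C where "killing_tensor W X Y \<kappa> K n A B C"
    "\<And>x p. x \<in> W \<Longrightarrow> F x p = quad X Y A B C x p"
proof -
  from F obtain u where u: "\<And>i j. i + j = 2 \<Longrightarrow> smooth_on W (u i j)"
    "\<And>x p. x \<in> W \<Longrightarrow> F x p = (\<Sum>(i, j) | i + j = (2::nat). u i j x * p $ 1 ^ i * p $ 2 ^ j)"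
    unfolding homogeneous_integral_on_def by blast
  obtain A B C where ABC: "smooth_on W A" "smooth_on W B" "smooth_on W C"
    "\<And>x p. x \<in> W \<Longrightarrow> F x p = quad X Y A B C x p"
    using quad_of_coefficients[OF u] by metis
  have "killing_tensor W X Y \<kappa> K n A B C"
  proof (rule killing_tensorI[OF ABC(1-3)])
    fix x p assume x: "x \<in> W"
    have "poisson_bracket (hamiltonian g) F x p =
        poisson_bracket (quad X Y (\<lambda>x. 1) (\<lambda>x. 0) (\<lambda>x. 1)) (quad X Y A B C) x p"
      by (rule poisson_bracket_cong[OF open_W x ham ABC(4)])
    then show "poisson_bracket (quad X Y (\<lambda>x. 1) (\<lambda>x. 0) (\<lambda>x. 1)) (quad X Y A B C) x p = 0"
      using F x by (simp add: homogeneous_integral_on_def)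
  qed
  with ABC(4) that show ?thesis by blast
qed

text \<open>As \<open>B = 0\<close>, the form is \<open>A\<close> times the Hamiltonian plus
  \<open>D\<close> times the squared momentum of \<open>Y\<close>, and \<open>A\<close> is constant
  because both frame derivatives vanish on a convex set.\<close>

lemma nondegenerate_integral:
  assumes ham: "\<And>x p. x \<in> W \<Longrightarrow> hamiltonian g x p = quad X Y (\<lambda>x. 1) (\<lambda>x. 0) (\<lambda>x. 1) x p"
    and F: "homogeneous_integral_on g W 2 F"
    and nondeg: "(\<forall>x\<in>W. j5 x \<noteq> 0) \<or> (\<forall>x\<in>W. j4 x \<noteq> 0)"
    and "convex W" "W \<noteq> {}"
  obtains a D where "smooth_on W D" "\<And>x. x \<in> W \<Longrightarrow> along X D x = 2 * \<kappa> x * D x"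
    "\<And>x. x \<in> W \<Longrightarrow> along Y D x = 0" "\<And>x. x \<in> W \<Longrightarrow> \<nu> x * D x = 0"
    "\<And>x p. x \<in> W \<Longrightarrow> F x p = a * hamiltonian g x p + quad X Y (\<lambda>x. 0) (\<lambda>x. 0) D x p"
proof -
  obtain A B C where kt: "killing_tensor W X Y \<kappa> K n A B C"
    and FQ: "\<And>x p. x \<in> W \<Longrightarrow> F x p = quad X Y A B C x p"
    using integral_killing_tensor[OF ham F] by metis
  interpret killing_tensor W X Y \<kappa> K n A B C by (rule kt)
  obtain c where c: "c \<in> W" using assms(5) by blast
  have Ac: "A x = A c" if "x \<in> W" for x
    using along_zero_imp_constant[OF assms(4) smooth_ABC(1) X_A _ that c]
      nondegenerate_solution(2)[OF nondeg] by blast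
  show ?thesis
  proof (rule that[of D "A c"])
    fix x p assume x: "x \<in> W"
    show "F x p = A c * hamiltonian g x p + quad X Y (\<lambda>x. 0) (\<lambda>x. 0) D x p"
      using Ac[OF x] nondegenerate_solution(1)[OF nondeg x]
      by (simp add: ham[OF x] FQ[OF x] quad_def D_def algebra_simps)
  qed (use nondegenerate_solution[OF nondeg] in auto)
qed

text \<open>The equations make the gradient of \<open>D\<close> a multiple of \<open>D\<close>
  itself, so a single zero spreads over the convex set.\<close>

lemma diagonal_solution_zero:
  assumes "convex W" "smooth_on W D" "\<And>x. x \<in> W \<Longrightarrow> along X D x = 2 * \<kappa> x * D x"
    "\<And>x. x \<in> W \<Longrightarrow> along Y D x = 0" "c \<in> W" "D c = 0" "x \<in> W"
  shows "D x = 0"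
proof -
  define d where "d x = X x $ 1 * Y x $ 2 - X x $ 2 * Y x $ 1" for x
  have d: "d x \<noteq> 0" if "x \<in> W" for x using frame_det[OF that] by (simp add: d_def)
  have [simp]: "smooth_on W d" by (simp add: d_def[abs_def])
  show ?thesis
  proof (rule log_gradient_zero[OF assms(1) open_W assms(2) _ _ _ _ assms(5-7)])
    show "smooth_on W (\<lambda>x. 2 * \<kappa> x * Y x $ 2 / d x)" "smooth_on W (\<lambda>x. - (2 * \<kappa> x) * Y x $ 1 / d x)"
      by (rule smooth_on_divide[OF open_W]; simp add: d)+
  qed (use pd_from_along[of _ D] assms(3,4) in \<open>auto simp: d_def\<close>)
qed

text \<open>\<open>exp (2 * h)\<close> solves the same linear equations as \<open>D\<close>, so the
  quotient has vanishing frame derivatives.\<close>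

lemma diagonal_solution_multiple:
  assumes "convex W" "smooth_on W D" "\<And>x. x \<in> W \<Longrightarrow> along X D x = 2 * \<kappa> x * D x"
    "\<And>x. x \<in> W \<Longrightarrow> along Y D x = 0"
    and h: "smooth_on W h" "\<And>x. x \<in> W \<Longrightarrow> along X h x = \<kappa> x" "\<And>x. x \<in> W \<Longrightarrow> along Y h x = 0"
    and "c \<in> W"
  obtains e where "\<And>x. x \<in> W \<Longrightarrow> D x = e * exp (2 * h x)"
proof (rule that)
  fix x assume x: "x \<in> W"
  define E where "E x = D x * exp (- 2 * h x)" for x
  have "E x = E c"
  proof (rule along_zero_imp_constant[OF assms(1) _ _ _ x assms(8)])
    show "smooth_on W E" unfolding E_def[abs_def] using assms(2) h(1) by simp
    show "along X E y = 0" "along Y E y = 0" if y: "y \<in> W" for y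
      unfolding E_def[abs_def] using assms(2-4) h y
      by (simp_all add: along_rules along_exp)
  qed
  then show "D x = E c * exp (2 * h x)"
    unfolding E_def by (simp add: exp_minus field_simps)
qed

text \<open>If \<open>\<nu>\<close> is nonzero somewhere on a small ball, \<open>D\<close> vanishes
  there, hence on the whole ball, and the integral is a multiple of the Hamiltonian. If
  \<open>\<nu>\<close> vanishes near \<open>x0\<close>, the germs of the Hamiltonian and of
  \<open>F0\<close> form a basis, which gives both the converse and the dimension.\<close>

theorem liouville_in_adapted_frame:
  assumes x0: "x0 \<in> W"
    and ham: "\<And>x p. x \<in> W \<Longrightarrow> hamiltonian g x p = quad X Y (\<lambda>x. 1) (\<lambda>x. 0) (\<lambda>x. 1) x p"
    and nondeg: "j5 x0 \<noteq> 0 \<or> j4 x0 \<noteq> 0"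
  shows "(liouville_near g x0 \<longleftrightarrow> (\<forall>\<^sub>F x in nhds x0. \<nu> x = 0)) \<and>
    (liouville_near g x0 \<longrightarrow> dim (integral_germs g x0 2) = 2)"
proof -
  define H where "H = hamiltonian g"
  \<comment> \<open>Fixing which of \<open>j5\<close>, \<open>j4\<close> is nonzero at
    \<open>x0\<close> makes the same one nonzero on a whole ball, as \<open>B_zero\<close>
    requires.\<close>
  obtain u where u: "u = j5 \<or> u = j4" "u x0 \<noteq> 0" using nondeg by blast
  have u_ev: "eventually (\<lambda>x. x \<in> W \<and> u x \<noteq> 0) (nhds x0)"
    by (rule smooth_nonzero_nhd[OF open_W]) (use u x0 in auto)
  have fr: "adapted_frame W X Y \<kappa> K n" by unfold_locales
  have W_ball: "adapted_frame (ball x0 s) X Y \<kappa> K n"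
      "(\<forall>x\<in>ball x0 s. j5 x \<noteq> 0) \<or> (\<forall>x\<in>ball x0 s. j4 x \<noteq> 0)"
      "\<And>x p. x \<in> ball x0 s \<Longrightarrow> hamiltonian g x p = quad X Y (\<lambda>x. 1) (\<lambda>x. 0) (\<lambda>x. 1) x p"
    if "\<And>x. x \<in> ball x0 s \<Longrightarrow> x \<in> W \<and> u x \<noteq> 0" for s
    using that adapted_frame_subset[OF fr, of "ball x0 s"] u(1) ham by blast+
  have imp: "\<forall>\<^sub>F x in nhds x0. \<nu> x = 0" if "liouville_near g x0"
  proof -
    from that obtain F U where F: "open U" "x0 \<in> U" "homogeneous_integral_on g U 2 F"
      and ne: "\<And>r. germ_at x0 F \<noteq> r *\<^sub>R germ_at x0 H"
      unfolding liouville_near_def integral_germs_def H_def by blast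
    have "eventually (\<lambda>x. x \<in> U \<and> x \<in> W \<and> u x \<noteq> 0) (nhds x0)"
      using eventually_conj[OF eventually_nhds_in_open[OF F(1,2)] u_ev] .
    then obtain s where s: "s > 0" "\<And>x. x \<in> ball x0 s \<Longrightarrow> x \<in> U \<and> x \<in> W \<and> u x \<noteq> 0"
      by (rule eventually_ball) blast
    note V = W_ball[of s]
    interpret V: adapted_frame "ball x0 s" X Y \<kappa> K n using V(1) s(2) by blast
    obtain a D where aD: "smooth_on (ball x0 s) D" "\<And>x. x \<in> ball x0 s \<Longrightarrow> along X D x = 2 * \<kappa> x * D x"
      "\<And>x. x \<in> ball x0 s \<Longrightarrow> along Y D x = 0" "\<And>x. x \<in> ball x0 s \<Longrightarrow> \<nu> x * D x = 0"
      "\<And>x p. x \<in> ball x0 s \<Longrightarrow> F x p = a * hamiltonian g x p + quad X Y (\<lambda>x. 0) (\<lambda>x. 0) D x p"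
    proof (rule V.nondegenerate_integral)
      show "homogeneous_integral_on g (ball x0 s) 2 F"
        by (rule homogeneous_integral_on_subset[OF F(3)]) (use s in auto)
    qed (use V s in auto)
    have "\<nu> x = 0" if x: "x \<in> ball x0 s" for x
    proof (rule ccontr)
      assume "\<nu> x \<noteq> 0"
      then have "D x = 0" using aD(4)[OF x] by simp
      then have "D y = 0" if "y \<in> ball x0 s" for y
        using V.diagonal_solution_zero[OF convex_ball aD(1-3) x _ that] by blast
      then have "germ_at x0 F = germ_at x0 (\<lambda>x p. a * H x p)"
        using s(1) by (intro germ_at_eqI[of "ball x0 s"]) (auto simp: aD(5) H_def quad_def)
      with ne[of a] show False by (simp add: germ_at_scaleR)
    qed
    then show ?thesis
      unfolding eventually_nhds using s(1) by (intro exI[of _ "ball x0 s"]) auto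
  qed
  moreover have "liouville_near g x0 \<and> dim (integral_germs g x0 2) = 2" if "\<forall>\<^sub>F x in nhds x0. \<nu> x = 0"
  proof -
    have "eventually (\<lambda>x. \<nu> x = 0 \<and> x \<in> W \<and> u x \<noteq> 0) (nhds x0)"
      using eventually_conj[OF that u_ev] .
    then obtain s where s: "s > 0" "\<And>x. x \<in> ball x0 s \<Longrightarrow> \<nu> x = 0 \<and> x \<in> W \<and> u x \<noteq> 0"
      by (rule eventually_ball) blast
    have V: "adapted_frame (ball x0 s) X Y \<kappa> K n" using W_ball(1)[of s] s by blast
    have hamV: "hamiltonian g x p = quad X Y (\<lambda>x. 1) (\<lambda>x. 0) (\<lambda>x. 1) x p" if "x \<in> ball x0 s" for x p
      using ham s(2)[OF that] by blast
    interpret V: adapted_frame "ball x0 s" X Y \<kappa> K n by (rule V)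
    obtain h where h: "smooth_on (ball x0 s) h" "\<And>x. x \<in> ball x0 s \<Longrightarrow> along X h x = \<kappa> x"
      "\<And>x. x \<in> ball x0 s \<Longrightarrow> along Y h x = 0"
      using V.integrating_factor[OF refl] s(2) by blast
    define F0 where "F0 = quad X Y (\<lambda>x. 0) (\<lambda>x. 0) (\<lambda>x. exp (2 * h x))"
    define a b where "a = germ_at x0 H" and "b = germ_at x0 F0"
    have "homogeneous_integral_on g (ball x0 s) 2 F0"
      unfolding F0_def using h
      by (intro V.quad_integral)
        (simp_all add: hamV V.poisson_bracket_quad[OF _ _ _ _ refl refl] V.along_rules V.along_exp)
    then have b: "b \<in> integral_germs g x0 2"
      unfolding b_def integral_germs_def using s(1) by (intro CollectI exI[of _ F0] conjI exI[of _ "ball x0 s"]) auto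
    have "homogeneous_integral_on g (ball x0 s) 2 (quad X Y (\<lambda>x. 1) (\<lambda>x. 0) (\<lambda>x. 1))"
      by (intro V.quad_integral)
        (simp_all add: hamV V.poisson_bracket_quad[OF _ _ _ _ refl refl] V.along_rules)
    moreover have "a = germ_at x0 (quad X Y (\<lambda>x. 1) (\<lambda>x. 0) (\<lambda>x. 1))"
      unfolding a_def H_def using s(1) hamV by (intro germ_at_eqI[of "ball x0 s"]) auto
    ultimately have a: "a \<in> integral_germs g x0 2"
      unfolding integral_germs_def using s(1) by (intro CollectI exI conjI[of "a = _"] exI[of _ "ball x0 s"]) auto
    have span: "\<Phi> \<in> span {a, b}" if \<Phi>: "\<Phi> \<in> integral_germs g x0 2" for \<Phi>
    proof -
      from \<Phi> obtain F U where F: "\<Phi> = germ_at x0 F" "open U" "x0 \<in> U" "homogeneous_integral_on g U 2 F"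
        unfolding integral_germs_def by blast
      \<comment> \<open>Each integral lives on its own neighbourhood, so the ball is shrunk once
        more; \<open>h\<close> and \<open>F0\<close> stay the same.\<close>
      have "eventually (\<lambda>x. x \<in> U \<and> x \<in> ball x0 s) (nhds x0)"
        using eventually_conj[OF eventually_nhds_in_open[OF F(2,3)] eventually_nhds_in_open[of "ball x0 s" x0]] s(1)
        by simp
      then obtain t where t: "t > 0" "\<And>x. x \<in> ball x0 t \<Longrightarrow> x \<in> U \<and> x \<in> ball x0 s"
        by (rule eventually_ball) blast
      have T: "adapted_frame (ball x0 t) X Y \<kappa> K n"
        "(\<forall>x\<in>ball x0 t. j5 x \<noteq> 0) \<or> (\<forall>x\<in>ball x0 t. j4 x \<noteq> 0)"
        using W_ball(1,2)[of t] s(2) t(2) by blast+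
      interpret T: adapted_frame "ball x0 t" X Y \<kappa> K n by (rule T)
      obtain e D where D: "smooth_on (ball x0 t) D" "\<And>x. x \<in> ball x0 t \<Longrightarrow> along X D x = 2 * \<kappa> x * D x"
        "\<And>x. x \<in> ball x0 t \<Longrightarrow> along Y D x = 0" "\<And>x. x \<in> ball x0 t \<Longrightarrow> \<nu> x * D x = 0"
        "\<And>x p. x \<in> ball x0 t \<Longrightarrow> F x p = e * hamiltonian g x p + quad X Y (\<lambda>x. 0) (\<lambda>x. 0) D x p"
      proof (rule T.nondegenerate_integral)
        show "homogeneous_integral_on g (ball x0 t) 2 F"
          by (rule homogeneous_integral_on_subset[OF F(4)]) (use t in auto)
      qed (use T t hamV in auto)
      obtain f where f: "\<And>x. x \<in> ball x0 t \<Longrightarrow> D x = f * exp (2 * h x)"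
      proof (rule T.diagonal_solution_multiple[where c = x0 and h = h, OF convex_ball D(1-3)])
        show "smooth_on (ball x0 t) h" using smooth_on_subset[OF h(1)] t(2) by blast
      qed (use h t in auto)
      have "\<Phi> = germ_at x0 (\<lambda>x p. e * H x p + f * F0 x p)"
        unfolding F(1) using t(1)
        by (intro germ_at_eqI[of "ball x0 t"]) (auto simp: D(5) f H_def F0_def quad_def)
      then show ?thesis
        unfolding span_pair by (auto simp: germ_at_add germ_at_scaleR a_def b_def)
    qed
    have indep: "r = 0 \<and> q = 0" if "r *\<^sub>R a + q *\<^sub>R b = 0" for r q
    proof -
      \<comment> \<open>The zero germ is represented by \<open>0 * H\<close>, to which
        \<open>germ_at_scaleR\<close> applies.\<close>
      have "germ_at x0 (\<lambda>x p. r * H x p + q * F0 x p) = germ_at x0 (\<lambda>x p. 0 * H x p)"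
        using that by (simp only: germ_at_add germ_at_scaleR a_def b_def) simp
      from germ_at_eqD[OF this] have *: "r * H x0 p + q * F0 x0 p = 0" for p by simp
      \<comment> \<open>At \<open>p\<close> the Hamiltonian is 1 and \<open>F0\<close> is 0, which
        gives \<open>r = 0\<close>; at \<open>p'\<close> the value of \<open>F0\<close> is positive,
        which then gives \<open>q = 0\<close>.\<close>
      obtain p :: "real^2" where p: "X x0 $ 1 * p $ 1 + X x0 $ 2 * p $ 2 = 1" "Y x0 $ 1 * p $ 1 + Y x0 $ 2 * p $ 2 = 0"
        using frame_momenta[OF x0] by metis
      obtain p' :: "real^2" where p': "X x0 $ 1 * p' $ 1 + X x0 $ 2 * p' $ 2 = 0" "Y x0 $ 1 * p' $ 1 + Y x0 $ 2 * p' $ 2 = 1"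
        using frame_momenta[OF x0] by metis
      show ?thesis
        using *[of p] *[of p'] by (simp add: H_def ham[OF x0] F0_def quad_def p p')
    qed
    have ne: "b \<noteq> r *\<^sub>R a" for r
      using indep[of "- r" 1] by auto
    have "a \<noteq> 0" using indep[of 1 0] by auto
    then have ind: "independent {b, a}"
      using ne by (auto simp: real_vector.independent_insert span_singleton)
    have "dim (integral_germs g x0 2) = 2"
    proof (rule real_vector.dim_unique[of "{b, a}"])
      show "integral_germs g x0 2 \<subseteq> span {b, a}" using span by (auto simp: insert_commute)
      show "card {b, a} = 2" using ne[of 1] by simp
    qed (use a b ind in auto)
    moreover have "liouville_near g x0"
      unfolding liouville_near_def using b ne by (auto simp: a_def H_def)
    ultimately show ?thesis by blast
  qed
  ultimately show ?thesis by blast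
qed

end

subsection \<open>Riemannian metrics in a chart\<close>

lemma matrix_inv_right:
  fixes m :: "real^'n^'n"
  assumes "det m \<noteq> 0"
  shows "m ** matrix_inv m = mat 1"
proof -
  have "invertible m" using assms by (simp add: invertible_det_nz)
  then show ?thesis
    unfolding matrix_inv_def invertible_def by (rule someI2_ex) blast
qed

lemma matrix_inv_2:
  fixes m :: "real^2^2"
  assumes "det m \<noteq> 0"
  shows "matrix_inv m $ 1 $ 1 = m $ 2 $ 2 / det m" "matrix_inv m $ 1 $ 2 = - m $ 1 $ 2 / det m"
    "matrix_inv m $ 2 $ 1 = - m $ 2 $ 1 / det m" "matrix_inv m $ 2 $ 2 = m $ 1 $ 1 / det m"
proof -
  have e: "(m ** matrix_inv m) $ i $ j = (if i = j then 1 else 0)" for i j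
    unfolding matrix_inv_right[OF assms] by (simp add: mat_def)
  define a b c d where "a = matrix_inv m $ 1 $ 1" "b = matrix_inv m $ 1 $ 2"
    "c = matrix_inv m $ 2 $ 1" "d = matrix_inv m $ 2 $ 2"
  have eqs: "m $ 1 $ 1 * a + m $ 1 $ 2 * c = 1" "m $ 1 $ 1 * b + m $ 1 $ 2 * d = 0"
    "m $ 2 $ 1 * a + m $ 2 $ 2 * c = 0" "m $ 2 $ 1 * b + m $ 2 $ 2 * d = 1"
    using e[of 1 1] e[of 1 2] e[of 2 1] e[of 2 2]
    by (simp_all add: matrix_matrix_mult_def sum_2 a_b_c_d_def)
  have "det m * a = m $ 2 $ 2" "det m * b = - m $ 1 $ 2" "det m * c = - m $ 2 $ 1" "det m * d = m $ 1 $ 1"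
    unfolding det_2 using eqs by algebra+
  then show "matrix_inv m $ 1 $ 1 = m $ 2 $ 2 / det m" "matrix_inv m $ 1 $ 2 = - m $ 1 $ 2 / det m"
    "matrix_inv m $ 2 $ 1 = - m $ 2 $ 1 / det m" "matrix_inv m $ 2 $ 2 = m $ 1 $ 1 / det m"
    unfolding a_b_c_d_def[symmetric] using assms by (simp_all add: field_simps)
qed

lemma tensor_eval_Nil: "tensor_eval T x [] = T [] x"
  by (simp add: tensor_eval_def)

text \<open>Peels off one argument, so that rewriting turns the sum over index lists into nested
  sums over single indices.\<close>

lemma tensor_eval_Cons:
  "tensor_eval T x (v # vs) = (\<Sum>i\<in>UNIV. v $ i * tensor_eval (\<lambda>is. T (i # is)) x vs)"
proof -
  have lists: "{is :: 2 list. length is = length (v # vs)} = (\<lambda>(i, is). i # is) ` (UNIV \<times> {is. length is = length vs})"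
    by (auto simp: length_Suc_conv image_iff)
  have "inj_on (\<lambda>(i, is). i # is) (UNIV \<times> {is :: 2 list. length is = length vs})"
    by (auto simp: inj_on_def)
  then have "tensor_eval T x (v # vs) = (\<Sum>(i, is)\<in>UNIV \<times> {is. length is = length vs}.
      T (i # is) x * (\<Prod>m<Suc (length vs). (v # vs) ! m $ ((i # is) ! m)))"
    unfolding tensor_eval_def lists by (subst sum.reindex) (auto simp: split_def)
  also have "\<dots> = (\<Sum>i\<in>UNIV. \<Sum>is | length is = length vs. v $ i * (T (i # is) x * (\<Prod>m<length vs. vs ! m $ (is ! m))))"
    by (subst sum.cartesian_product[symmetric]) (simp del: prod.lessThan_Suc add: prod.lessThan_Suc_shift ac_simps)
  finally show ?thesis
    by (simp add: tensor_eval_def sum_distrib_left)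
qed

locale chart_metric =
  fixes W :: "(real^2) set" and g :: metric
  assumes open_W: "open W"
    and smooth_g [simp]: "smooth_on W (\<lambda>x. g x $ i $ j)"
    and sym_g: "x \<in> W \<Longrightarrow> transpose (g x) = g x"
    and pos_g: "x \<in> W \<Longrightarrow> v \<noteq> 0 \<Longrightarrow> v \<bullet> (g x *v v) > 0"
begin

lemmas [simp] = smooth_on_simps[OF open_W]

lemmas pd_rules = pd_smooth[where U = W]

lemma g_21: "x \<in> W \<Longrightarrow> g x $ 2 $ 1 = g x $ 1 $ 2"
  using arg_cong[OF sym_g, of x "\<lambda>m. m $ 1 $ 2"] by (simp add: transpose_def)

lemma pd_g_21: "x \<in> W \<Longrightarrow> pd i (\<lambda>x. g x $ 2 $ 1) x = pd i (\<lambda>x. g x $ 1 $ 2) x"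
  by (rule pd_cong[OF open_W _ g_21])

lemma inner_g: "x \<in> W \<Longrightarrow> u \<bullet> (g x *v v) = g x $ 1 $ 1 * u $ 1 * v $ 1
    + g x $ 1 $ 2 * (u $ 1 * v $ 2 + u $ 2 * v $ 1) + g x $ 2 $ 2 * u $ 2 * v $ 2"
  by (simp add: inner_vec_def matrix_vector_mult_def sum_2 g_21 algebra_simps)

lemma inner_g_sym: "x \<in> W \<Longrightarrow> u \<bullet> (g x *v v) = v \<bullet> (g x *v u)"
  by (simp add: inner_g algebra_simps)

lemma g_11_pos: "x \<in> W \<Longrightarrow> g x $ 1 $ 1 > 0"
  using pos_g[of x "axis 1 1"] by (simp add: inner_g) (simp add: axis_def)

lemma det_g: "x \<in> W \<Longrightarrow> det (g x) = g x $ 1 $ 1 * g x $ 2 $ 2 - g x $ 1 $ 2 * g x $ 1 $ 2"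
  by (simp add: det_2 g_21)

lemma det_g_pos:
  assumes x: "x \<in> W"
  shows "det (g x) > 0"
proof -
  \<comment> \<open>This vector is orthogonal to the first coordinate vector, and its squared length
    is \<open>g x $ 1 $ 1 * det (g x)\<close>.\<close>
  define v :: "real^2" where "v = vector [- g x $ 1 $ 2, g x $ 1 $ 1]"
  have "v \<noteq> 0" using g_11_pos[OF x] by (auto simp: v_def vec_eq_iff forall_2)
  from pos_g[OF x this] have "g x $ 1 $ 1 * det (g x) > 0"
    unfolding inner_g[OF x] det_g[OF x] by (simp add: v_def algebra_simps)
  then show ?thesis using g_11_pos[OF x] by (simp add: zero_less_mult_iff)
qed

lemma smooth_det [simp]: "smooth_on W (\<lambda>x. det (g x))"
  by (simp add: det_2)

lemma smooth_inv [simp]: "smooth_on W (\<lambda>x. matrix_inv (g x) $ i $ j)"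
proof -
  have nz: "det (g x) \<noteq> 0" if "x \<in> W" for x using det_g_pos[OF that] by simp
  have s: "smooth_on W (\<lambda>x. g x $ i $ j / det (g x))" "smooth_on W (\<lambda>x. - g x $ i $ j / det (g x))" for i j
    by (rule smooth_on_divide[OF open_W]; simp add: nz)+
  have "smooth_on W (\<lambda>x. matrix_inv (g x) $ 1 $ 1)"
    by (rule smooth_on_cong[OF open_W s(1)[of 2 2]]) (simp add: matrix_inv_2 nz)
  moreover have "smooth_on W (\<lambda>x. matrix_inv (g x) $ 1 $ 2)"
    by (rule smooth_on_cong[OF open_W s(2)[of 1 2]]) (simp add: matrix_inv_2 nz)
  moreover have "smooth_on W (\<lambda>x. matrix_inv (g x) $ 2 $ 1)"
    by (rule smooth_on_cong[OF open_W s(2)[of 2 1]]) (simp add: matrix_inv_2 nz)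
  moreover have "smooth_on W (\<lambda>x. matrix_inv (g x) $ 2 $ 2)"
    by (rule smooth_on_cong[OF open_W s(1)[of 1 1]]) (simp add: matrix_inv_2 nz)
  ultimately show ?thesis using exhaust_2[of i] exhaust_2[of j] by auto
qed

lemma smooth_christoffel [simp]: "smooth_on W (christoffel g k i j)"
  by (simp add: christoffel_def[abs_def] sum_2)

lemma christoffel_sym: "x \<in> W \<Longrightarrow> christoffel g k 2 1 x = christoffel g k 1 2 x"
  by (simp add: christoffel_def sum_2 pd_g_21 algebra_simps)

text \<open>Lowering the upper index gives the Christoffel symbols of the first kind; multiplying by
  the determinant keeps the computation polynomial.\<close>

lemma christoffel_lower:
  assumes x: "x \<in> W"
  shows "g x $ l $ 1 * christoffel g 1 i j x + g x $ l $ 2 * christoffel g 2 i j x =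
    (pd i (\<lambda>y. g y $ j $ l) x + pd j (\<lambda>y. g y $ i $ l) x - pd l (\<lambda>y. g y $ i $ j) x) / 2"
proof -
  have d: "det (g x) \<noteq> 0" using det_g_pos[OF x] by simp
  define e where "e l = pd i (\<lambda>y. g y $ j $ l) x + pd j (\<lambda>y. g y $ i $ l) x - pd l (\<lambda>y. g y $ i $ j) x" for l
  have 1: "2 * (det (g x) * christoffel g 1 i j x) = g x $ 2 $ 2 * e 1 - g x $ 1 $ 2 * e 2"
    and 2: "2 * (det (g x) * christoffel g 2 i j x) = - g x $ 1 $ 2 * e 1 + g x $ 1 $ 1 * e 2"
    using d by (simp_all add: christoffel_def sum_2 matrix_inv_2 g_21[OF x] e_def[symmetric] field_simps)
  have "det (g x) * (2 * (g x $ l $ 1 * christoffel g 1 i j x + g x $ l $ 2 * christoffel g 2 i j x))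
      = g x $ l $ 1 * (2 * (det (g x) * christoffel g 1 i j x)) + g x $ l $ 2 * (2 * (det (g x) * christoffel g 2 i j x))"
    by (simp add: algebra_simps)
  also have "\<dots> = det (g x) * e l"
    unfolding 1 2 using exhaust_2[of l] by (auto simp: g_21[OF x] det_g[OF x] algebra_simps)
  finally have "det (g x) * (2 * (g x $ l $ 1 * christoffel g 1 i j x + g x $ l $ 2 * christoffel g 2 i j x))
      = det (g x) * e l" .
  then show ?thesis using d by (simp add: e_def)
qed

text \<open>The metric is parallel: each derivative is the sum of two symbols of the first kind, in
  which the other terms cancel.\<close>

lemma metric_compatible:
  assumes x: "x \<in> W"
  shows "pd i (\<lambda>y. g y $ 1 $ 1) x = 2 * (g x $ 1 $ 1 * christoffel g 1 i 1 x + g x $ 1 $ 2 * christoffel g 2 i 1 x)"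
    "pd i (\<lambda>y. g y $ 1 $ 2) x = g x $ 1 $ 1 * christoffel g 1 i 2 x + g x $ 1 $ 2 * christoffel g 2 i 2 x
      + g x $ 1 $ 2 * christoffel g 1 i 1 x + g x $ 2 $ 2 * christoffel g 2 i 1 x"
    "pd i (\<lambda>y. g y $ 2 $ 2) x = 2 * (g x $ 1 $ 2 * christoffel g 1 i 2 x + g x $ 2 $ 2 * christoffel g 2 i 2 x)"
  using christoffel_lower[OF x, of 1 i 1] christoffel_lower[OF x, of 1 i 2]
    christoffel_lower[OF x, of 2 i 1] christoffel_lower[OF x, of 2 i 2] exhaust_2[of i]
  by (auto simp: g_21[OF x] pd_g_21[OF x] field_simps)

lemma smooth_riemann [simp]: "smooth_on W (riemann g l k i j)"
  by (simp add: riemann_def[abs_def] sum_2)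

lemma smooth_gauss_curvature [simp]: "smooth_on W (gauss_curvature g)"
  unfolding gauss_curvature_def[abs_def] sum_2
  by (rule smooth_on_divide[OF open_W]; use det_g_pos in force)

lemma smooth_iter_diff_K [simp]: "smooth_on W (iter_diff_K g l is)"
proof (induction l arbitrary: "is")
  case (Suc l)
  have "smooth_on W (\<lambda>x. \<Sum>m\<in>S. \<Sum>s\<in>UNIV. christoffel g s k (js ! m) x * iter_diff_K g l (js[m := s]) x)"
    if "finite S" for S k js
    using that by (induction S rule: finite_induct) (simp_all add: sum_2 Suc)
  then show ?case
    by (cases "is") (simp_all add: Suc cov_deriv.simps[abs_def] flip: eta_contract_eq)
qed (simp add: eta_contract_eq)

lemma smooth_grad [simp]: "smooth_on W (\<lambda>x. grad_K g x $ i)"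
  by (simp add: grad_K_def matrix_vector_mult_def sum_2)

lemma smooth_I3 [simp]: "smooth_on W (I3 g)"
  by (simp add: I3_def[abs_def] inner_vec_def matrix_vector_mult_def sum_2)

end

section \<open>The Levi-Civita connection and curvature in an orthonormal frame\<close>

definition covd :: "metric \<Rightarrow> 2 \<Rightarrow> (real^2 \<Rightarrow> real^2) \<Rightarrow> 2 \<Rightarrow> real^2 \<Rightarrow> real" where
  "covd g i V k x = pd i (\<lambda>y. V y $ k) x + christoffel g k i 1 x * V x $ 1 + christoffel g k i 2 x * V x $ 2"

locale orthonormal_frame = chart_metric +
  fixes X Y :: "real^2 \<Rightarrow> real^2"
  assumes smooth_XY [simp]: "smooth_on W (\<lambda>x. X x $ i)" "smooth_on W (\<lambda>x. Y x $ i)"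
    and XX: "x \<in> W \<Longrightarrow> X x \<bullet> (g x *v X x) = 1"
    and XY: "x \<in> W \<Longrightarrow> X x \<bullet> (g x *v Y x) = 0"
    and YY: "x \<in> W \<Longrightarrow> Y x \<bullet> (g x *v Y x) = 1"
begin

text \<open>The connection form \<open>\<omega> i = g(\<nabla>\<^sub>i X, Y)\<close>.\<close>

definition \<omega> :: "2 \<Rightarrow> real^2 \<Rightarrow> real" where
  "\<omega> i x = (g x $ 1 $ 1 * Y x $ 1 + g x $ 1 $ 2 * Y x $ 2) * covd g i X 1 x
     + (g x $ 1 $ 2 * Y x $ 1 + g x $ 2 $ 2 * Y x $ 2) * covd g i X 2 x"

lemma smooth_\<omega> [simp]: "smooth_on W (\<omega> i)"
  by (simp add: \<omega>_def[abs_def] covd_def)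

lemma det_frame:
  assumes x: "x \<in> W"
  shows "(X x $ 1 * Y x $ 2 - X x $ 2 * Y x $ 1)\<^sup>2 * det (g x) = 1"
proof -
  have "(X x $ 1 * Y x $ 2 - X x $ 2 * Y x $ 1)\<^sup>2 * det (g x)
      = (X x \<bullet> (g x *v X x)) * (Y x \<bullet> (g x *v Y x)) - (X x \<bullet> (g x *v Y x))\<^sup>2"
    unfolding inner_g[OF x] det_g[OF x] by algebra
  then show ?thesis using XX[OF x] XY[OF x] YY[OF x] by simp
qed

lemma det_frame_nonzero: "x \<in> W \<Longrightarrow> X x $ 1 * Y x $ 2 - X x $ 2 * Y x $ 1 \<noteq> 0"
  using det_frame[of x] by auto

lemma expand:
  assumes x: "x \<in> W"
    and X0: "v \<bullet> (g x *v X x) = p" and Y0: "v \<bullet> (g x *v Y x) = q"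
  shows "v $ k = p * X x $ k + q * Y x $ k"
proof -
  \<comment> \<open>\<open>(x1, x2)\<close> and \<open>(y1, y2)\<close> are the covectors dual to
    \<open>X\<close> and \<open>Y\<close>, and \<open>d\<close> is the determinant of this
    coframe.\<close>
  define x1 x2 y1 y2 where "x1 = g x $ 1 $ 1 * X x $ 1 + g x $ 1 $ 2 * X x $ 2"
    "x2 = g x $ 1 $ 2 * X x $ 1 + g x $ 2 $ 2 * X x $ 2"
    "y1 = g x $ 1 $ 1 * Y x $ 1 + g x $ 1 $ 2 * Y x $ 2"
    "y2 = g x $ 1 $ 2 * Y x $ 1 + g x $ 2 $ 2 * Y x $ 2"
  note defs = this
  define d where "d = x1 * y2 - x2 * y1"
  have "d = (X x $ 1 * Y x $ 2 - X x $ 2 * Y x $ 1) * det (g x)"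
    unfolding d_def defs det_g[OF x] by algebra
  then have d: "d \<noteq> 0" using det_frame_nonzero[OF x] det_g_pos[OF x] by simp
  have "x1 * X x $ 1 + x2 * X x $ 2 = 1" "x1 * Y x $ 1 + x2 * Y x $ 2 = 0"
    "y1 * X x $ 1 + y2 * X x $ 2 = 0" "y1 * Y x $ 1 + y2 * Y x $ 2 = 1"
    using XX[OF x] XY[OF x] YY[OF x] unfolding defs inner_g[OF x] by (simp_all add: algebra_simps)
  then have 1: "d * X x $ 1 = y2" "d * Y x $ 1 = - x2" "d * X x $ 2 = - y1" "d * Y x $ 2 = x1"
    unfolding d_def by algebra+
  have pq: "p = x1 * v $ 1 + x2 * v $ 2" "q = y1 * v $ 1 + y2 * v $ 2"
    using X0 Y0 unfolding defs inner_g[OF x] by (simp_all add: algebra_simps)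
  have "d * v $ 1 = p * y2 - q * x2" "d * v $ 2 = q * x1 - p * y1"
    unfolding d_def pq by algebra+
  then have "d * v $ 1 = d * (p * X x $ 1 + q * Y x $ 1)" "d * v $ 2 = d * (p * X x $ 2 + q * Y x $ 2)"
    using 1 by algebra+
  then show ?thesis using d exhaust_2[of k] by auto
qed

lemma frame_dual:
  assumes x: "x \<in> W"
  shows "X x $ 1 * (g x $ 1 $ 1 * X x $ 1 + g x $ 1 $ 2 * X x $ 2)
     + Y x $ 1 * (g x $ 1 $ 1 * Y x $ 1 + g x $ 1 $ 2 * Y x $ 2) = 1"
  using expand[OF x refl refl, of "axis 1 1" 1] inner_g[OF x]
  by (simp add: axis_def algebra_simps)

text \<open>The constant inner products \<open>XX\<close>, \<open>YY\<close> and \<open>XY\<close>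
  are differentiated, and \<open>metric_compatible\<close> turns the derivatives of \<open>g\<close>
  into Christoffel symbols.\<close>

lemma connection_orthonormal:
  assumes x: "x \<in> W"
  shows "vector [covd g i X 1 x, covd g i X 2 x] \<bullet> (g x *v X x) = 0"
    "vector [covd g i Y 1 x, covd g i Y 2 x] \<bullet> (g x *v Y x) = 0"
    "vector [covd g i Y 1 x, covd g i Y 2 x] \<bullet> (g x *v X x) = - \<omega> i x"
    "vector [covd g i X 1 x, covd g i X 2 x] \<bullet> (g x *v Y x) = \<omega> i x"
proof -
  show 1: "vector [covd g i X 1 x, covd g i X 2 x] \<bullet> (g x *v Y x) = \<omega> i x"
    unfolding inner_g[OF x] \<omega>_def by (simp add: algebra_simps)
  have "pd i (\<lambda>x. g x $ 1 $ 1 * X x $ 1 * X x $ 1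
    + g x $ 1 $ 2 * (X x $ 1 * X x $ 2 + X x $ 2 * X x $ 1) + g x $ 2 $ 2 * X x $ 2 * X x $ 2) x = 0"
    using pd_cong[OF open_W x, of _ "\<lambda>x. 1"] XX by (simp add: inner_g)
  then show "vector [covd g i X 1 x, covd g i X 2 x] \<bullet> (g x *v X x) = 0"
    using x unfolding inner_g[OF x]
    by (simp add: pd_rules metric_compatible covd_def) algebra
  have "pd i (\<lambda>x. g x $ 1 $ 1 * Y x $ 1 * Y x $ 1
    + g x $ 1 $ 2 * (Y x $ 1 * Y x $ 2 + Y x $ 2 * Y x $ 1) + g x $ 2 $ 2 * Y x $ 2 * Y x $ 2) x = 0"
    using pd_cong[OF open_W x, of _ "\<lambda>x. 1"] YY by (simp add: inner_g)
  then show "vector [covd g i Y 1 x, covd g i Y 2 x] \<bullet> (g x *v Y x) = 0"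
    using x unfolding inner_g[OF x]
    by (simp add: pd_rules metric_compatible covd_def) algebra
  have "pd i (\<lambda>x. g x $ 1 $ 1 * X x $ 1 * Y x $ 1
    + g x $ 1 $ 2 * (X x $ 1 * Y x $ 2 + X x $ 2 * Y x $ 1) + g x $ 2 $ 2 * X x $ 2 * Y x $ 2) x = 0"
    using pd_cong[OF open_W x, of _ "\<lambda>x. 0"] XY by (simp add: inner_g)
  then show "vector [covd g i Y 1 x, covd g i Y 2 x] \<bullet> (g x *v X x) = - \<omega> i x"
    using x unfolding inner_g[OF x] \<omega>_def
    by (simp add: pd_rules metric_compatible covd_def) algebra
qed

lemma covd_frame:
  assumes x: "x \<in> W"
  shows "covd g i X k x = \<omega> i x * Y x $ k" "covd g i Y k x = - \<omega> i x * X x $ k"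
  using expand[OF x connection_orthonormal(1,4)[OF x], of i k]
    expand[OF x connection_orthonormal(3,2)[OF x], of i k] exhaust_2[of k]
  by auto

lemma pd_frame:
  assumes x: "x \<in> W"
  shows "pd i (\<lambda>y. X y $ k) x = \<omega> i x * Y x $ k
      - christoffel g k i 1 x * X x $ 1 - christoffel g k i 2 x * X x $ 2"
    "pd i (\<lambda>y. Y y $ k) x = - \<omega> i x * X x $ k
      - christoffel g k i 1 x * Y x $ 1 - christoffel g k i 2 x * Y x $ 2"
  using covd_frame[OF x, of i k] by (simp_all add: covd_def)

text \<open>The connection is torsion-free, so the bracket is the difference of the covariant
  derivatives, which \<open>covd_frame\<close> expresses by \<open>\<omega>\<close>.\<close>

lemma bracket:
  assumes x: "x \<in> W"
  shows "along X (\<lambda>x. Y x $ k) x - along Y (\<lambda>x. X x $ k) x =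
    - (\<omega> 1 x * X x $ 1 + \<omega> 2 x * X x $ 2) * X x $ k
    - (\<omega> 1 x * Y x $ 1 + \<omega> 2 x * Y x $ 2) * Y x $ k"
  unfolding along_def pd_frame[OF x] christoffel_sym[OF x] by algebra

text \<open>Cartan's structure equation. It is the symmetry of the second derivatives of the frame
  components, with first derivatives replaced by \<open>pd_frame\<close>.\<close>

lemma riemann_frame:
  assumes x: "x \<in> W"
  shows "riemann g k 1 1 2 x * X x $ 1 + riemann g k 2 1 2 x * X x $ 2
      = (pd 1 (\<omega> 2) x - pd 2 (\<omega> 1) x) * Y x $ k"
    "riemann g k 1 1 2 x * Y x $ 1 + riemann g k 2 1 2 x * Y x $ 2
      = - (pd 1 (\<omega> 2) x - pd 2 (\<omega> 1) x) * X x $ k"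
proof -
  have X2: "pd j (pd i (\<lambda>y. X y $ k)) x = pd j (\<lambda>x. \<omega> i x * Y x $ k
      - christoffel g k i 1 x * X x $ 1 - christoffel g k i 2 x * X x $ 2) x" for i j
    by (rule pd_cong[OF open_W x pd_frame(1)])
  have Y2: "pd j (pd i (\<lambda>y. Y y $ k)) x = pd j (\<lambda>x. - \<omega> i x * X x $ k
      - christoffel g k i 1 x * Y x $ 1 - christoffel g k i 2 x * Y x $ 2) x" for i j
    by (rule pd_cong[OF open_W x pd_frame(2)])
  show "riemann g k 1 1 2 x * X x $ 1 + riemann g k 2 1 2 x * X x $ 2
      = (pd 1 (\<omega> 2) x - pd 2 (\<omega> 1) x) * Y x $ k"
    using pd_commute[OF open_W smooth_XY(1) x, of 1 2 k] x unfolding X2 riemann_def sum_2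
    by (simp add: pd_rules pd_frame christoffel_sym) algebra
  show "riemann g k 1 1 2 x * Y x $ 1 + riemann g k 2 1 2 x * Y x $ 2
      = - (pd 1 (\<omega> 2) x - pd 2 (\<omega> 1) x) * X x $ k"
    using pd_commute[OF open_W smooth_XY(2) x, of 1 2 k] x unfolding Y2 riemann_def sum_2
    by (simp add: pd_rules pd_frame christoffel_sym) algebra
qed

lemma gauss_curvature_frame:
  assumes x: "x \<in> W"
  shows "gauss_curvature g x = - (X x $ 1 * Y x $ 2 - X x $ 2 * Y x $ 1) * (pd 1 (\<omega> 2) x - pd 2 (\<omega> 1) x)"
proof -
  define e where "e = X x $ 1 * Y x $ 2 - X x $ 2 * Y x $ 1"
  define w where "w = pd 1 (\<omega> 2) x - pd 2 (\<omega> 1) x"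
  \<comment> \<open>\<open>e\<close> times the second coordinate vector is \<open>X $ 1\<close>
    times \<open>Y\<close> minus \<open>Y $ 1\<close> times \<open>X\<close>; the curvature operator
    is applied to this combination.\<close>
  have r: "riemann g k 2 1 2 x * e = - w * (X x $ 1 * X x $ k + Y x $ 1 * Y x $ k)" for k
    using riemann_frame[OF x, of k] unfolding e_def w_def by algebra
  have "gauss_curvature g x * det (g x) = g x $ 1 $ 1 * riemann g 1 2 1 2 x + g x $ 1 $ 2 * riemann g 2 2 1 2 x"
    using det_g_pos[OF x] by (simp add: gauss_curvature_def sum_2)
  then have "gauss_curvature g x * det (g x) * e = - w"
    using r[of 1] r[of 2] frame_dual[OF x] by algebra
  \<comment> \<open>A further factor \<open>e\<close> produces \<open>e\<^sup>2 * det (g x)\<close>,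
    which is 1 by \<open>det_frame\<close>.\<close>
  then have "gauss_curvature g x * (e\<^sup>2 * det (g x)) = - e * w"
    by algebra
  then show ?thesis
    using det_frame[OF x] by (simp add: e_def w_def)
qed

end

subsection \<open>Covariant derivatives of the curvature\<close>

lemma iter_diff_K_1: "iter_diff_K g (Suc 0) [i] = pd i (gauss_curvature g)"
  by (rule ext) simp

lemma iter_diff_K_2: "iter_diff_K g 2 [i, j] x = pd i (pd j (gauss_curvature g)) x
    - christoffel g 1 i j x * pd 1 (gauss_curvature g) x - christoffel g 2 i j x * pd 2 (gauss_curvature g) x"
  by (simp add: numeral_2_eq_2 iter_diff_K_1 sum_2 del: iter_diff_K.simps(1))
    (simp add: iter_diff_K_1[simplified] sum_2)

lemma cov_deriv_2: "cov_deriv g T [k, i, j] x = pd k (T [i, j]) x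
    - christoffel g 1 k i x * T [1, j] x - christoffel g 2 k i x * T [2, j] x
    - christoffel g 1 k j x * T [i, 1] x - christoffel g 2 k j x * T [i, 2] x"
  by (simp add: sum_2)

lemma iter_diff_K_3: "iter_diff_K g 3 = cov_deriv g (iter_diff_K g 2)"
  by (simp only: numeral_3_eq_3 numeral_2_eq_2 iter_diff_K.simps(2))

definition hess :: "metric \<Rightarrow> real^2 \<Rightarrow> real^2 \<Rightarrow> real^2 \<Rightarrow> real" where
  "hess g x u v = tensor_eval (iter_diff_K g 2) x [u, v]"

lemma hess_expand: "hess g x u v = u $ 1 * v $ 1 * iter_diff_K g 2 [1, 1] x + u $ 1 * v $ 2 * iter_diff_K g 2 [1, 2] x
    + u $ 2 * v $ 1 * iter_diff_K g 2 [2, 1] x + u $ 2 * v $ 2 * iter_diff_K g 2 [2, 2] x"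
  by (simp add: hess_def tensor_eval_Cons tensor_eval_Nil sum_2 algebra_simps)

definition nabla :: "metric \<Rightarrow> (real^2 \<Rightarrow> real^2) \<Rightarrow> (real^2 \<Rightarrow> real^2) \<Rightarrow> real^2 \<Rightarrow> real^2" where
  "nabla g U V x = (\<chi> k. U x $ 1 * covd g 1 V k x + U x $ 2 * covd g 2 V k x)"

context chart_metric
begin

lemmas along_rules = along_smooth[where U = W]

text \<open>This and \<open>third_derivative_frame\<close> are the Leibniz rule for covariant
  derivatives, which trades components for derivatives along vector fields.\<close>

lemma hess_frame:
  assumes x: "x \<in> W" and [simp]: "\<And>i. smooth_on W (\<lambda>x. V x $ i)"
  shows "hess g x (U x) (V x) = along U (along V (gauss_curvature g)) x
    - nabla g U V x $ 1 * pd 1 (gauss_curvature g) x - nabla g U V x $ 2 * pd 2 (gauss_curvature g) x"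
  using x unfolding hess_expand iter_diff_K_2 nabla_def along_def[abs_def] covd_def
  by (simp add: pd_rules algebra_simps)

lemma third_derivative_frame:
  assumes x: "x \<in> W"
    and [simp]: "\<And>i. smooth_on W (\<lambda>x. V x $ i)" "\<And>i. smooth_on W (\<lambda>x. Z x $ i)"
  shows "tensor_eval (iter_diff_K g 3) x [U x, V x, Z x] = along U (\<lambda>x. hess g x (V x) (Z x)) x
    - hess g x (nabla g U V x) (Z x) - hess g x (V x) (nabla g U Z x)"
  using x unfolding hess_expand along_def
  by (simp add: pd_rules tensor_eval_Cons tensor_eval_Nil sum_2 iter_diff_K_3 cov_deriv_2 nabla_def covd_def algebra_simps)

lemma grad_inner:
  assumes x: "x \<in> W"
  shows "v \<bullet> (g x *v grad_K g x) = v $ 1 * pd 1 (gauss_curvature g) x + v $ 2 * pd 2 (gauss_curvature g) x"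
proof -
  have "g x *v grad_K g x = (\<chi> i. pd i (gauss_curvature g) x)"
    using matrix_inv_right[of "g x"] det_g_pos[OF x]
    by (simp add: grad_K_def matrix_vector_mul_assoc)
  then show ?thesis by (simp add: inner_vec_def sum_2)
qed

end

section \<open>The frame of the normalized gradient of the curvature and its rotation\<close>

lemma rot90_scaleR: "rot90 g \<sigma> x (c *\<^sub>R v) = c *\<^sub>R rot90 g \<sigma> x v"
  by (simp add: rot90_def vec_eq_iff forall_2 matrix_vector_mult_scaleR)

definition unit_grad :: "metric \<Rightarrow> real^2 \<Rightarrow> real^2" where
  "unit_grad g x = (1 / sqrt (I3 g x)) *\<^sub>R grad_K g x"

locale curvature_frame = chart_metric +
  fixes \<sigma> :: real
  assumes \<sigma>: "\<sigma> \<in> {1, -1}" and I3_pos: "x \<in> W \<Longrightarrow> I3 g x > 0"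
begin

abbreviation "n \<equiv> \<lambda>x. sqrt (I3 g x)"
abbreviation "K \<equiv> gauss_curvature g"
abbreviation "X \<equiv> unit_grad g"
abbreviation "Y \<equiv> \<lambda>x. rot90 g \<sigma> x (unit_grad g x)"

lemma n_pos: "x \<in> W \<Longrightarrow> n x > 0"
  using I3_pos by simp

lemma smooth_n [simp]: "smooth_on W n"
  using smooth_on_sqrt[OF open_W smooth_I3] I3_pos by blast

lemma grad_eq: "x \<in> W \<Longrightarrow> grad_K g x = n x *\<^sub>R X x"
  using n_pos[of x] by (simp add: unit_grad_def)

lemma sgrad_eq: "x \<in> W \<Longrightarrow> sgrad_K g \<sigma> x = n x *\<^sub>R Y x"
  by (simp add: sgrad_K_def grad_eq rot90_scaleR)

lemma smooth_X [simp]: "smooth_on W (\<lambda>x. X x $ i)"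
proof -
  have "smooth_on W (\<lambda>x. grad_K g x $ i / n x)"
    by (rule smooth_on_divide[OF open_W]) (use n_pos in force)+
  then show ?thesis by (simp add: unit_grad_def)
qed

lemma smooth_Y [simp]: "smooth_on W (\<lambda>x. Y x $ i)"
proof -
  have [simp]: "smooth_on W (\<lambda>x. \<sigma> / sqrt (det (g x)))"
    by (rule smooth_on_divide[OF open_W _ smooth_on_sqrt[OF open_W]]) (use det_g_pos in force)+
  have "smooth_on W (\<lambda>x. \<sigma> / sqrt (det (g x)) * (- ((g x *v X x) $ 2)))"
    "smooth_on W (\<lambda>x. \<sigma> / sqrt (det (g x)) * (g x *v X x) $ 1)"
    by (intro smooth_on_mult[OF open_W] smooth_on_minus[OF open_W]; simp add: matrix_vector_mult_def sum_2)+
  then show ?thesis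
    using exhaust_2[of i] by (auto simp: rot90_def)
qed

lemma X_unit: "x \<in> W \<Longrightarrow> X x \<bullet> (g x *v X x) = 1"
  using I3_pos[of x] by (simp add: unit_grad_def matrix_vector_mult_scaleR I3_def[symmetric])

sublocale orthonormal_frame W g X Y
proof
  fix x assume x: "x \<in> W"
  note rot = rot90_is_rotation[where g = g and x = x and \<sigma> = \<sigma>, OF sym_g[OF x] det_g_pos[OF x] \<sigma>]
  show "X x \<bullet> (g x *v X x) = 1" "X x \<bullet> (g x *v Y x) = 0" "Y x \<bullet> (g x *v Y x) = 1"
    using rot X_unit[OF x] by auto
qed auto

lemma along_X_K: "x \<in> W \<Longrightarrow> along X K x = n x"
  using grad_inner[of x "X x"] XX[of x] by (simp add: along_def grad_eq matrix_vector_mult_scaleR)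

lemma along_Y_K: "x \<in> W \<Longrightarrow> along Y K x = 0"
  using grad_inner[of x "Y x"] XY[of x] inner_g_sym[of x "X x" "Y x"]
  by (simp add: along_def grad_eq matrix_vector_mult_scaleR)

text \<open>The values of the connection form on the frame: \<open>\<xi>\<close> is the geodesic
  curvature of the gradient lines of \<open>K\<close> and, up to orientation,
  \<open>\<kappa>\<close> that of its level curves.\<close>

definition \<xi> :: "real^2 \<Rightarrow> real" where "\<xi> x = \<omega> 1 x * X x $ 1 + \<omega> 2 x * X x $ 2"
definition \<kappa> :: "real^2 \<Rightarrow> real" where "\<kappa> x = \<omega> 1 x * Y x $ 1 + \<omega> 2 x * Y x $ 2"

lemma smooth_\<xi>\<kappa> [simp]: "smooth_on W \<xi>" "smooth_on W \<kappa>"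
  by (simp_all add: \<xi>_def[abs_def] \<kappa>_def[abs_def])

lemma nabla_frame:
  assumes x: "x \<in> W"
  shows "nabla g X X x = \<xi> x *\<^sub>R Y x" "nabla g X Y x = - \<xi> x *\<^sub>R X x"
    "nabla g Y X x = \<kappa> x *\<^sub>R Y x" "nabla g Y Y x = - \<kappa> x *\<^sub>R X x"
  by (simp_all add: nabla_def vec_eq_iff covd_frame[OF x] \<xi>_def \<kappa>_def algebra_simps)

text \<open>The frame derivatives of \<open>K\<close> are \<open>n\<close> and 0, so apart from the
  derivative of \<open>n\<close> only connection terms remain.\<close>

lemma hess_XX: "x \<in> W \<Longrightarrow> hess g x (X x) (X x) = along X n x"
  and hess_XY: "x \<in> W \<Longrightarrow> hess g x (X x) (Y x) = \<xi> x * n x"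
  and hess_YY: "x \<in> W \<Longrightarrow> hess g x (Y x) (Y x) = \<kappa> x * n x"
proof -
  assume x: "x \<in> W"
  have *: "along V (along X K) x = along V n x" "along V (along Y K) x = 0" for V
    using along_cong[OF open_W x along_X_K] along_cong[OF open_W x along_Y_K]
    by (simp_all add: along_rules[OF x])
  show "hess g x (X x) (X x) = along X n x"
    using hess_frame[OF x, of X X] along_Y_K[OF x] unfolding * nabla_frame[OF x]
    by (simp add: along_def algebra_simps) algebra
  show "hess g x (X x) (Y x) = \<xi> x * n x"
    using hess_frame[OF x, of Y X] along_X_K[OF x] unfolding * nabla_frame[OF x]
    by (simp add: along_def algebra_simps) algebra
  show "hess g x (Y x) (Y x) = \<kappa> x * n x"
    using hess_frame[OF x, of Y Y] along_X_K[OF x] unfolding * nabla_frame[OF x]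
    by (simp add: along_def algebra_simps) algebra
qed

lemma hess_scaleR: "hess g x (a *\<^sub>R u) (b *\<^sub>R v) = a * b * hess g x u v"
  unfolding hess_expand by (simp add: algebra_simps)

lemma I4:
  assumes x: "x \<in> W"
  shows "I4a g \<sigma> x = n x ^ 2 * along X n x" "I4b g \<sigma> x = n x ^ 3 * \<xi> x" "I4c g \<sigma> x = n x ^ 3 * \<kappa> x"
proof -
  have "I4a g \<sigma> x = hess g x (grad_K g x) (grad_K g x)" "I4b g \<sigma> x = hess g x (grad_K g x) (sgrad_K g \<sigma> x)"
    "I4c g \<sigma> x = hess g x (sgrad_K g \<sigma> x) (sgrad_K g \<sigma> x)"
    by (simp_all add: Iij_def hess_def numeral_2_eq_2)
  then show "I4a g \<sigma> x = n x ^ 2 * along X n x" "I4b g \<sigma> x = n x ^ 3 * \<xi> x" "I4c g \<sigma> x = n x ^ 3 * \<kappa> x"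
    by (simp_all only: grad_eq[OF x] sgrad_eq[OF x] hess_scaleR hess_XX[OF x] hess_XY[OF x] hess_YY[OF x]
        power2_eq_square power3_eq_cube ac_simps)
qed

end

section \<open>The invariants when the gradient lines are geodesics\<close>

locale curvature_adapted_frame = curvature_frame +
  assumes I4b_zero: "x \<in> W \<Longrightarrow> I4b g \<sigma> x = 0"
begin

lemma \<xi>_zero: "x \<in> W \<Longrightarrow> \<xi> x = 0"
  using I4(2)[of x] I4b_zero[of x] n_pos[of x] by simp

text \<open>Evaluates \<open>d\<omega>(X,Y) = X(\<omega>(Y)) - Y(\<omega>(X)) -
  \<omega>([X,Y])\<close>: the left side is \<open>- K\<close>, and with \<open>\<xi> = 0\<close>
  the right side is \<open>X(\<kappa>) + \<kappa>\<^sup>2\<close>.\<close>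

lemma gauss_equation:
  assumes x: "x \<in> W"
  shows "along X \<kappa> x = - K x - \<kappa> x ^ 2"
proof -
  have "along Y \<xi> x = 0"
    using along_cong[OF open_W x \<xi>_zero] by (simp add: along_rules[OF x])
  moreover have "along X \<kappa> x = along X (\<omega> 1) x * Y x $ 1 + \<omega> 1 x * along X (\<lambda>x. Y x $ 1) x
      + along X (\<omega> 2) x * Y x $ 2 + \<omega> 2 x * along X (\<lambda>x. Y x $ 2) x"
    unfolding \<kappa>_def[abs_def] using x by (simp add: along_rules)
  moreover have "along Y \<xi> x = along Y (\<omega> 1) x * X x $ 1 + \<omega> 1 x * along Y (\<lambda>x. X x $ 1) x
      + along Y (\<omega> 2) x * X x $ 2 + \<omega> 2 x * along Y (\<lambda>x. X x $ 2) x"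
    unfolding \<xi>_def[abs_def] using x by (simp add: along_rules)
  moreover have "along X (\<omega> 1) x * Y x $ 1 + along X (\<omega> 2) x * Y x $ 2
      - along Y (\<omega> 1) x * X x $ 1 - along Y (\<omega> 2) x * X x $ 2 = - K x"
    unfolding gauss_curvature_frame[OF x] along_def by algebra
  moreover have "\<omega> 1 x * (along X (\<lambda>x. Y x $ 1) x - along Y (\<lambda>x. X x $ 1) x)
      + \<omega> 2 x * (along X (\<lambda>x. Y x $ 2) x - along Y (\<lambda>x. X x $ 2) x) + \<xi> x * \<xi> x + \<kappa> x * \<kappa> x = 0"
    unfolding bracket[OF x] \<xi>_def \<kappa>_def by algebra
  ultimately show ?thesis
    using \<xi>_zero[OF x] by (simp add: algebra_simps power2_eq_square)
qed

sublocale adapted: adapted_frame W X Y \<kappa> K n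
proof
  fix x i assume x: "x \<in> W"
  show "along X (\<lambda>x. Y x $ i) x - along Y (\<lambda>x. X x $ i) x = - \<kappa> x * Y x $ i"
    using bracket[OF x, of i, folded \<xi>_def \<kappa>_def] \<xi>_zero[OF x] by simp
qed (use open_W gauss_equation along_X_K along_Y_K det_frame_nonzero n_pos in force)+

text \<open>Covariant derivatives of the frame along \<open>X\<close> vanish as
  \<open>\<xi> = 0\<close>. In \<open>I5d\<close> the derivative of \<open>Y\<close> along itself is
  a multiple of \<open>X\<close>, so it only meets mixed entries of the Hessian, which
  vanish.\<close>

lemma I5:
  assumes x: "x \<in> W"
  shows "I5a g \<sigma> x = n x ^ 3 * along X (along X n) x"
    "I5c g \<sigma> x = n x ^ 3 * along X (\<lambda>x. \<kappa> x * n x) x" "I5d g \<sigma> x = n x ^ 4 * adapted.\<nu> x"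
proof -
  have scale: "tensor_eval (iter_diff_K g 3) x [a *\<^sub>R u, b *\<^sub>R v, c *\<^sub>R w]
      = a * b * c * tensor_eval (iter_diff_K g 3) x [u, v, w]" for a b c u v w
    by (simp add: tensor_eval_Cons tensor_eval_Nil sum_2 algebra_simps)
  have h0: "hess g x (0 *\<^sub>R u) v = 0" "hess g x u (0 *\<^sub>R v) = 0" for u v
    by (simp_all add: hess_expand)
  have hX: "along V (\<lambda>x. hess g x (X x) (X x)) x = along V (along X n) x"
    and hY: "along V (\<lambda>x. hess g x (Y x) (Y x)) x = along V (\<lambda>x. \<kappa> x * n x) x" for V
    by (rule along_cong[OF open_W x hess_XX], assumption, rule along_cong[OF open_W x hess_YY])
  have "along Y (along X K) x = 0"
    using along_cong[OF open_W x along_X_K, where V = Y] adapted.Y_n[OF x] by simp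
  then have "hess g x (Y x) (X x) = - \<kappa> x * along Y K x"
    unfolding hess_frame[OF x smooth_X, of Y] nabla_frame[OF x] by (simp add: along_def algebra_simps)
  then have hYX: "hess g x (X x) (Y x) = 0" "hess g x (Y x) (X x) = 0"
    using hess_XY[OF x] \<xi>_zero[OF x] along_Y_K[OF x] by auto
  have T: "tensor_eval (iter_diff_K g 3) x [X x, X x, X x] = along X (along X n) x"
    "tensor_eval (iter_diff_K g 3) x [X x, Y x, Y x] = along X (\<lambda>x. \<kappa> x * n x) x"
    "tensor_eval (iter_diff_K g 3) x [Y x, Y x, Y x] = n x * adapted.\<nu> x"
  proof -
    show "tensor_eval (iter_diff_K g 3) x [X x, X x, X x] = along X (along X n) x"
      using third_derivative_frame[OF x, of X X X] by (simp add: nabla_frame[OF x] \<xi>_zero[OF x] h0[simplified] hX)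
    show "tensor_eval (iter_diff_K g 3) x [X x, Y x, Y x] = along X (\<lambda>x. \<kappa> x * n x) x"
      using third_derivative_frame[OF x, of Y Y X] by (simp add: nabla_frame[OF x] \<xi>_zero[OF x] h0[simplified] hY)
    have "tensor_eval (iter_diff_K g 3) x [Y x, Y x, Y x] = along Y (\<lambda>x. \<kappa> x * n x) x"
      using third_derivative_frame[OF x, of Y Y Y] hYX hess_scaleR[of x "- \<kappa> x" "X x" 1 "Y x"]
        hess_scaleR[of x 1 "Y x" "- \<kappa> x" "X x"] by (simp add: nabla_frame[OF x] hY)
    then show "tensor_eval (iter_diff_K g 3) x [Y x, Y x, Y x] = n x * adapted.\<nu> x"
      using x by (simp add: along_rules adapted.Y_n adapted.\<nu>_def)
  qed
  have "I5a g \<sigma> x = tensor_eval (iter_diff_K g 3) x [grad_K g x, grad_K g x, grad_K g x]"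
    "I5c g \<sigma> x = tensor_eval (iter_diff_K g 3) x [grad_K g x, sgrad_K g \<sigma> x, sgrad_K g \<sigma> x]"
    "I5d g \<sigma> x = tensor_eval (iter_diff_K g 3) x [sgrad_K g \<sigma> x, sgrad_K g \<sigma> x, sgrad_K g \<sigma> x]"
    by (simp_all add: Iij_def numeral_2_eq_2 numeral_3_eq_3 del: iter_diff_K.simps)
  then show "I5a g \<sigma> x = n x ^ 3 * along X (along X n) x"
    "I5c g \<sigma> x = n x ^ 3 * along X (\<lambda>x. \<kappa> x * n x) x" "I5d g \<sigma> x = n x ^ 4 * adapted.\<nu> x"
    by (simp_all only: grad_eq[OF x] sgrad_eq[OF x] scale T power3_eq_cube power4_eq_xxxx ac_simps)
qed

text \<open>Every term carries the factor \<open>n ^ 6\<close> once \<open>I3\<close> is written as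
  \<open>n ^ 2\<close>; \<open>m\<close> stands for \<open>n x\<close> to make the claim a
  polynomial identity.\<close>

lemma J5_eq:
  assumes x: "x \<in> W"
  shows "J5 g \<sigma> x = - 25 * n x ^ 6 * adapted.j5 x"
proof -
  define m where "m = n x"
  have I3: "I3 g x = m ^ 2" using I3_pos[OF x] by (simp add: m_def)
  have n': "along X n x = adapted.\<mu> x * n x"
    using adapted.\<mu>_n[OF x] by (simp add: adapted.n'_def)
  have n'': "along X (along X n) x = along X adapted.\<mu> x * n x + adapted.\<mu> x * along X n x"
    using adapted.along_\<mu>[OF x, of X] by (simp add: adapted.n'_def)
  have kn: "along X (\<lambda>x. \<kappa> x * n x) x = (- K x - \<kappa> x ^ 2) * n x + \<kappa> x * along X n x"
    using x by (simp add: along_rules gauss_equation)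
  have j: "25 * adapted.j5 x = 5 * (- K x - \<kappa> x ^ 2 - along X adapted.\<mu> x) + (\<kappa> x - adapted.\<mu> x) ^ 2 + 25 * K x"
    unfolding adapted.j5_def adapted.along_\<beta>[OF x] gauss_equation[OF x] adapted.\<beta>_def
    by (simp add: power2_eq_square field_simps)
  have "J5 g \<sigma> x = - (25 * adapted.j5 x) * n x ^ 6"
    unfolding J5_def I2_def I4[OF x] I5[OF x] kn n'' n' j
    unfolding m_def[symmetric] unfolding I3 by algebra
  then show ?thesis by simp
qed

lemma J4_eq:
  assumes x: "x \<in> W"
  shows "J4 g \<sigma> x = 25 * n x ^ 9 * adapted.j4 x"
proof -
  define m where "m = n x"
  have I3: "I3 g x = m ^ 2" using I3_pos[OF x] by (simp add: m_def)
  have "5 * adapted.\<beta> x = \<kappa> x - adapted.\<mu> x" by (simp add: adapted.\<beta>_def)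
  \<comment> \<open>Expressing the derivative of \<open>n\<close> by \<open>\<beta>\<close> instead
    of \<open>\<mu>\<close> brings it into the variables of \<open>j4\<close>.\<close>
  then have n': "along X n x = (\<kappa> x - 5 * adapted.\<beta> x) * n x"
    using adapted.\<mu>_n[OF x] by (simp add: adapted.n'_def)
  show ?thesis
    unfolding J4_def I2_def I4[OF x] n' adapted.j4_def
    unfolding m_def[symmetric] unfolding I3 by algebra
qed

text \<open>The vector \<open>v\<close> is dual to \<open>p\<close>; its frame coefficients are the
  momenta, and the Hamiltonian is \<open>p\<close> applied to \<open>v\<close>.\<close>

lemma hamiltonian_quad:
  assumes x: "x \<in> W"
  shows "hamiltonian g x p = quad X Y (\<lambda>x. 1) (\<lambda>x. 0) (\<lambda>x. 1) x p"
proof -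
  define v where "v = matrix_inv (g x) *v p"
  have "g x *v v = p"
    using matrix_inv_right[of "g x"] det_g_pos[OF x] by (simp add: v_def matrix_vector_mul_assoc)
  then have "v \<bullet> (g x *v u) = u $ 1 * p $ 1 + u $ 2 * p $ 2" for u
    using inner_g_sym[OF x, of v u] by (simp add: inner_vec_def sum_2)
  then have v: "v $ k = (X x $ 1 * p $ 1 + X x $ 2 * p $ 2) * X x $ k
      + (Y x $ 1 * p $ 1 + Y x $ 2 * p $ 2) * Y x $ k" for k
    by (intro expand[OF x])
  have "hamiltonian g x p = p $ 1 * v $ 1 + p $ 2 * v $ 2"
    by (simp add: hamiltonian_def v_def matrix_vector_mult_def sum_2 algebra_simps)
  then show ?thesis
    unfolding v quad_def by algebra
qed

theorem liouville_iff:
  assumes x0: "x0 \<in> W" and J: "J5 g \<sigma> x0 \<noteq> 0 \<or> J4 g \<sigma> x0 \<noteq> 0"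
  shows "(liouville_near g x0 \<longleftrightarrow> (\<forall>\<^sub>F x in nhds x0. I5d g \<sigma> x = 0)) \<and>
    (liouville_near g x0 \<longrightarrow> dim (integral_germs g x0 2) = 2)"
proof -
  have "adapted.j5 x0 \<noteq> 0 \<or> adapted.j4 x0 \<noteq> 0"
    using J by (auto simp: J5_eq[OF x0] J4_eq[OF x0])
  moreover have "(\<forall>\<^sub>F x in nhds x0. I5d g \<sigma> x = 0) \<longleftrightarrow> (\<forall>\<^sub>F x in nhds x0. adapted.\<nu> x = 0)"
  proof (rule eventually_cong)
    show "\<forall>\<^sub>F x in nhds x0. x \<in> W" using eventually_nhds_in_open[OF open_W x0] .
    show "I5d g \<sigma> x = 0 \<longleftrightarrow> adapted.\<nu> x = 0" if "x \<in> W" for x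
      using n_pos[OF that] by (simp add: I5(3)[OF that])
  qed
  ultimately show ?thesis
    using adapted.liouville_in_adapted_frame[OF x0 hamiltonian_quad] by blast
qed

end

section \<open>Passage from the surface to the frame\<close>

lemma J_zero_of_grad_zero:
  assumes "grad_K g x = 0"
  shows "J5 g \<sigma> x = 0" "J4 g \<sigma> x = 0"
proof -
  have s: "sgrad_K g \<sigma> x = 0"
    using rot90_scaleR[of g \<sigma> x 0 0] by (simp add: sgrad_K_def assms)
  have "I3 g x = 0" "I4a g \<sigma> x = 0" "I4c g \<sigma> x = 0"
    by (simp_all add: I3_def Iij_def assms s numeral_2_eq_2 tensor_eval_Cons)
  then show "J5 g \<sigma> x = 0" "J4 g \<sigma> x = 0"
    by (simp_all add: J5_def J4_def)
qed

theorem theorem6: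
  fixes M :: "'a topology" and A :: "'a chart set" and g :: "'a chart \<Rightarrow> metric"
    and p0 :: 'a and U :: "'a set" and \<phi> :: "'a \<Rightarrow> real^2" and \<sigma> :: real
  assumes "riemannian_surface M A g"
    and "(U, \<phi>) \<in> A" and "p0 \<in> U"
    and "\<sigma> \<in> {1, -1}"
    and "\<forall>\<^sub>F x in nhds (\<phi> p0). I4b (g (U, \<phi>)) \<sigma> x = 0"
    and "J5 (g (U, \<phi>)) \<sigma> (\<phi> p0) \<noteq> 0 \<or> J4 (g (U, \<phi>)) \<sigma> (\<phi> p0) \<noteq> 0"
  shows "(liouville_near (g (U, \<phi>)) (\<phi> p0) \<longleftrightarrow>
           (\<forall>\<^sub>F x in nhds (\<phi> p0). I5d (g (U, \<phi>)) \<sigma> x = 0)) \<and>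
         (liouville_near (g (U, \<phi>)) (\<phi> p0) \<longrightarrow>
           dim (integral_germs (g (U, \<phi>)) (\<phi> p0) 2) = 2)"
proof -
  define h where "h = g (U, \<phi>)"
  define x0 where "x0 = \<phi> p0"
  have "open (chart_image (U, \<phi>))"
    using assms(1,2) unfolding riemannian_surface_def smooth_surface_def by (elim conjE) (drule (1) bspec, elim conjE)
  then have chart: "open (\<phi> ` U)" "x0 \<in> \<phi> ` U"
    using assms(3) by (auto simp: x0_def)
  have "(\<forall>i j. smooth_on (chart_image (U, \<phi>)) (\<lambda>x. h x $ i $ j)) \<and>
      (\<forall>x\<in>chart_image (U, \<phi>). transpose (h x) = h x \<and> (\<forall>v. v \<noteq> 0 \<longrightarrow> v \<bullet> (h x *v v) > 0))"
    using assms(1,2) unfolding riemannian_surface_def h_def by (elim conjE) (rule bspec)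
  then have metric: "\<And>i j. smooth_on (\<phi> ` U) (\<lambda>x. h x $ i $ j)"
    "\<And>x. x \<in> \<phi> ` U \<Longrightarrow> transpose (h x) = h x"
    "\<And>x v. x \<in> \<phi> ` U \<Longrightarrow> v \<noteq> 0 \<Longrightarrow> v \<bullet> (h x *v v) > 0"
    by auto
  interpret chart_metric "\<phi> ` U" h
    by unfold_locales (use chart metric in auto)
  \<comment> \<open>At a critical point of \<open>K\<close> both \<open>J5\<close> and
    \<open>J4\<close> would vanish, so the nondegeneracy hypothesis provides the gradient direction
    on which the frame is built.\<close>
  have "grad_K h x0 \<noteq> 0"
    using assms(6) J_zero_of_grad_zero by (auto simp: h_def x0_def)
  then have I3_0: "I3 h x0 \<noteq> 0"
    using metric(3)[OF chart(2), of "grad_K h x0"] by (simp add: I3_def)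
  have pos: "I3 h x > 0" if "I3 h x \<noteq> 0" "x \<in> \<phi> ` U" for x
    using that metric(3)[OF that(2), of "grad_K h x"] by (cases "grad_K h x = 0") (auto simp: I3_def)
  \<comment> \<open>The frame is set up on a smaller neighbourhood, where \<open>K\<close> has no
    critical points and \<open>I4b\<close> vanishes.\<close>
  have ev: "\<forall>\<^sub>F x in nhds x0. I3 h x > 0 \<and> x \<in> \<phi> ` U \<and> I4b h \<sigma> x = 0"
    using smooth_nonzero_nhd[OF chart(1) smooth_I3 chart(2) I3_0] assms(5)[folded h_def x0_def]
    by eventually_elim (auto intro: pos)
  obtain V where V: "open V" "x0 \<in> V"
    and sub: "\<forall>x\<in>V. I3 h x > 0 \<and> x \<in> \<phi> ` U \<and> I4b h \<sigma> x = 0"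
    using iffD1[OF eventually_nhds ev] by (elim exE conjE)
  interpret V: curvature_adapted_frame V h \<sigma>
  proof unfold_locales
    show "smooth_on V (\<lambda>x. h x $ i $ j)" for i j
      by (rule smooth_on_subset[OF metric(1)]) (use sub in blast)
  qed (use V(1) sub metric(2,3) assms(4) in auto)
  show ?thesis
    using V.liouville_iff[OF V(2)] assms(6) by (simp add: h_def x0_def)
qed

end
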